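(* Let $\alpha$ be a composition of $n$. Then: (a) $P_{\mathcal{V}_\alpha}=P_{D_{\alpha^{\mathrm c};\,\mathsf{read}(\mathscr{T}'_\alpha)}}$ and $P_{X_\alpha}=P_{D_{\alpha^{\mathrm c};\,\mathsf{read}(\mathsf{T}'_\alpha)}}$. (b) For $1\le i\le\ell(\alpha)$ let $k_i=\sum_{i+1\le j\le\ell(\alpha)}(\alpha_j-1)$. Then $$D_{\alpha^{\mathrm c};\,\mathsf{read}(\mathscr{T}'_\alpha)}=\{(1,i):(i,1)\in\mathtt{cd}(\alpha)\}\cup\{(j+k_i,i):(i,j)\in\mathtt{cd}(\alpha)\text{ with }j\ge2\},$$ $$D_{\alpha^{\mathrm c};\,\mathsf{read}(\mathsf{T}'_\alpha)}=\{(i,j):(j,i)\in\mathtt{cd}(\alpha)\}.$$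
   Context: Permutations in $\mathfrak{S}_n$ are written in one-line notation (words in $1,\dots,n$ without repetition are regarded as permutations) and composed as functions; $s_i=(i\ i{+}1)$; $\ell$ is the length; $\mathrm{Des}_L(\sigma)=\{i\in[n-1]:\ell(s_i\sigma)<\ell(\sigma)\}$. The left weak Bruhat order $\preceq_L$ has covers $\sigma\prec s_i\sigma$ when $\ell(s_i\sigma)>\ell(\sigma)$; $[\sigma,\rho]_L$ denotes an interval. $w_0$ is the longest element of $\mathfrak{S}_n$. For $\alpha\models n$, $\mathrm{set}(\alpha)=\{\alpha_1,\alpha_1+\alpha_2,\dots,\alpha_1+\cdots+\alpha_{\ell(\alpha)-1}\}\subseteq[n-1]$, $\alpha^{\mathrm c}$ is the composition with $\mathrm{set}(\alpha^{\mathrm c})=[n-1]\setminus\mathrm{set}(\alpha)$, and $w_0(\alpha)$ is the longest element of the parabolic subgroup generated by $\{s_i:i\in\mathrm{set}(\alpha)\}$. For a poset $P$ on $[n]$, $\Sigma_R(P)=\{\sigma\in\mathfrak{S}_n:\sigma^{-1}(i)<\sigma^{-1}(j)\text{ whenever }i\prec_P j\}$. For $\sigma\preceq_L\rho$ there is a unique poset $P$ on $[n]$ with $\Sigma_R(P)=\{w_0\gamma^{-1}:\gamma\in[\sigma,\rho]_L\}$. The composition diagram $\mathtt{cd}(\alpha)$ is the left-justified array whose $i$th row from the top has $\alpha_i$ boxes; $(i,j)\in\mathtt{cd}(\alpha)$ is the box in the $i$th row from the top and $j$th column from the left. For a filling $T$ of $\mathtt{cd}(\alpha)$, $\mathsf{read}(T)$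 is the word obtained by reading the entries from right to left in each row, starting with the top row. Fillings of $\mathtt{cd}(\alpha)$: $\mathscr{T}_\alpha=\mathsf{T}_\alpha$ is filled with $1,\dots,n$ from left to right and top to bottom; $\mathscr{T}'_\alpha$ has first column $1,\dots,\ell(\alpha)$ from top to bottom and the remaining boxes filled with $\ell(\alpha)+1,\dots,n$ from left to right in each row, from the bottom row to the top row; $\mathsf{T}'_\alpha$ is filled with $1,\dots,n$ from top to bottom in each column, from the leftmost column to the rightmost. $P_{\mathcal{V}_\alpha}$ is the unique poset on $[n]$ with $\Sigma_R(P_{\mathcal{V}_\alpha})=\{w_0\gamma^{-1}:\gamma\in[\mathsf{read}(\mathscr{T}_\alpha),\mathsf{read}(\mathscr{T}'_\alpha)]_L\}$, and $P_{X_\alpha}$ the unique poset on $[n]$ with $\Sigma_R(P_{X_\alpha})=\{w_0\gamma^{-1}:\gamma\in[\mathsf{read}(\mathsf{T}_\alpha),\mathsf{read}(\mathsf{T}'_\alpha)]_L\}$. (These intervals come from the $0$-Hecke modules $\mathcal{V}_\alpha$, $X_\alpha$ of the dual immaculate and extended Schur functions.) For an $n$-element $D\subseteq\mathbb{N}^2$ ($\mathbb{N}=\{1,2,\dots\}$) whose sets of first and second coordinates are initial segments $[l]$, $[k]$ of $\mathbb{N}$, view $(x,y)\in D$ as a box in column $x$ (from the left) and row $y$ (from the bottom). Let $(x_i,y_i)$ be the $i$th element of $D$ enumerated along rows from left to right, starting with the uppermost row; $P_D$ is the poset on $[n]$ with $i\preceq_{P_D}j$ iff $x_i\le x_j$ and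 $y_i\le y_j$. For $\beta\models n$ and $\rho\in\mathfrak{S}_n$ with $w_0(\beta)\preceq_L\rho$, $D_{\beta;\rho}$ is defined as follows. Let $\mathrm{set}(\beta^{\mathrm c})=\{z_1<\cdots<z_l\}$, $z_0=0$, $z_{l+1}=n$, and $R_j=\{\rho(r):z_{j-1}+1\le r\le z_j\}$ for $1\le j\le l+1$. Let $\mathrm{Des}_L(\rho)=\{k_1<\cdots<k_e\}$, $k_0=0$, $k_{e+1}=n$, and $C_i=\{c:k_{i-1}+1\le c\le k_i\}$ for $1\le i\le e+1$. Then $D_{\beta;\rho}=\{(i,j)\in\mathbb{N}^2:R_j\cap C_i\ne\emptyset\}$. *)

theory Defs
  imports "HOL-Algebra.Sym_Groups"
begin

text \<open>
  Permutations of \<open>{1..n}\<close> are functions \<open>nat \<Rightarrow> nat\<close> with \<open>\<sigma> permutes {1..n}\<close>, so they are the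
  identity outside \<open>{1..n}\<close>, and multiplication is composition of functions.
  The inverse of a permutation is written \<open>inv'\<close>, the abbreviation of \<^theory>\<open>HOL-Algebra.Sym_Groups\<close>
  for the functional inverse.
\<close>

definition perm_of_word :: "nat list \<Rightarrow> nat \<Rightarrow> nat" where
  "perm_of_word w i = (if i \<in> {1..length w} then w ! (i - 1) else i)"

section \<open>Length, left weak Bruhat order and longest elements\<close>

definition simple_refl :: "nat \<Rightarrow> nat \<Rightarrow> nat" where
  "simple_refl i = transpose i (i + 1)"

definition simple_prod :: "nat list \<Rightarrow> nat \<Rightarrow> nat" where
  "simple_prod is = foldr (\<lambda>i \<tau>. simple_refl i \<circ> \<tau>) is id"

definition len :: "nat \<Rightarrow> (nat \<Rightarrow> nat) \<Rightarrow> nat" where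
  "len n \<sigma> = (LEAST k. \<exists>is. length is = k \<and> set is \<subseteq> {1..<n} \<and> simple_prod is = \<sigma>)"

definition DesL :: "nat \<Rightarrow> (nat \<Rightarrow> nat) \<Rightarrow> nat set" where
  "DesL n \<sigma> = {i \<in> {1..<n}. len n (simple_refl i \<circ> \<sigma>) < len n \<sigma>}"

definition weakL_cover :: "nat \<Rightarrow> (nat \<Rightarrow> nat) \<Rightarrow> (nat \<Rightarrow> nat) \<Rightarrow> bool" where
  "weakL_cover n \<sigma> \<tau> \<longleftrightarrow>
     \<sigma> permutes {1..n} \<and>
     (\<exists>i\<in>{1..<n}. \<tau> = simple_refl i \<circ> \<sigma> \<and> len n (simple_refl i \<circ> \<sigma>) > len n \<sigma>)"

definition weakL :: "nat \<Rightarrow> (nat \<Rightarrow> nat) \<Rightarrow> (nat \<Rightarrow> nat) \<Rightarrow> bool" where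
  "weakL n = (weakL_cover n)\<^sup>*\<^sup>*"

definition weakL_interval :: "nat \<Rightarrow> (nat \<Rightarrow> nat) \<Rightarrow> (nat \<Rightarrow> nat) \<Rightarrow> (nat \<Rightarrow> nat) set" where
  "weakL_interval n \<sigma> \<rho> = {\<gamma>. \<gamma> permutes {1..n} \<and> weakL n \<sigma> \<gamma> \<and> weakL n \<gamma> \<rho>}"

definition longest_elem :: "nat \<Rightarrow> (nat \<Rightarrow> nat) set \<Rightarrow> nat \<Rightarrow> nat" where
  "longest_elem n W = (THE w. w \<in> W \<and> (\<forall>v\<in>W. len n v \<le> len n w))"

definition w0 :: "nat \<Rightarrow> nat \<Rightarrow> nat" where
  "w0 n = longest_elem n (carrier (sym_group n))"

section \<open>Compositions\<close>

definition composition_of :: "nat \<Rightarrow> nat list \<Rightarrow> bool" where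
  "composition_of n \<alpha> \<longleftrightarrow> (\<forall>a\<in>set \<alpha>. a \<ge> 1) \<and> sum_list \<alpha> = n"

definition comp_set :: "nat list \<Rightarrow> nat set" where
  "comp_set \<alpha> = {sum_list (take k \<alpha>) | k. 1 \<le> k \<and> k < length \<alpha>}"

definition comp_compl :: "nat list \<Rightarrow> nat list" where
  "comp_compl \<alpha> =
     (THE \<beta>. composition_of (sum_list \<alpha>) \<beta> \<and> comp_set \<beta> = {1..<sum_list \<alpha>} - comp_set \<alpha>)"

definition w0_comp :: "nat list \<Rightarrow> nat \<Rightarrow> nat" where
  "w0_comp \<alpha> =
     longest_elem (sum_list \<alpha>) (generate (sym_group (sum_list \<alpha>)) (simple_refl ` comp_set \<alpha>))"

section \<open>Posets on \<open>{1..n}\<close>, given by their reflexive order relations\<close>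

definition SigmaR :: "nat \<Rightarrow> (nat \<times> nat) set \<Rightarrow> (nat \<Rightarrow> nat) set" where
  "SigmaR n P =
     {\<sigma>. \<sigma> permutes {1..n} \<and> (\<forall>i j. (i, j) \<in> P \<and> i \<noteq> j \<longrightarrow> inv' \<sigma> i < inv' \<sigma> j)}"

definition interval_poset :: "nat \<Rightarrow> (nat \<Rightarrow> nat) \<Rightarrow> (nat \<Rightarrow> nat) \<Rightarrow> (nat \<times> nat) set" where
  "interval_poset n \<sigma> \<rho> =
     (THE P. partial_order_on {1..n} P \<and>
             SigmaR n P = (\<lambda>\<gamma>. w0 n \<circ> inv' \<gamma>) ` weakL_interval n \<sigma> \<rho>)"

section \<open>Composition diagrams and their fillings\<close>

definition cd :: "nat list \<Rightarrow> (nat \<times> nat) set" where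
  "cd \<alpha> = {(i, j). 1 \<le> i \<and> i \<le> length \<alpha> \<and> 1 \<le> j \<and> j \<le> \<alpha> ! (i - 1)}"

definition reading_word :: "nat list \<Rightarrow> (nat \<times> nat \<Rightarrow> nat) \<Rightarrow> nat list" where
  "reading_word \<alpha> T =
     concat (map (\<lambda>i. map (\<lambda>j. T (i, j)) (rev [1..<\<alpha> ! (i - 1) + 1])) [1..<length \<alpha> + 1])"

abbreviation read_perm :: "nat list \<Rightarrow> (nat \<times> nat \<Rightarrow> nat) \<Rightarrow> nat \<Rightarrow> nat" where
  "read_perm \<alpha> T \<equiv> perm_of_word (reading_word \<alpha> T)"

text \<open>
  Filling boxes with consecutive numbers along a prescribed order puts into a box the number of
  boxes which come no later than it.
\<close>

definition filling_T :: "nat list \<Rightarrow> nat \<times> nat \<Rightarrow> nat" where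
  "filling_T \<alpha> = (\<lambda>(i, j). card {(i', j') \<in> cd \<alpha>. i' < i \<or> i' = i \<and> j' \<le> j})"

definition filling_V' :: "nat list \<Rightarrow> nat \<times> nat \<Rightarrow> nat" where
  "filling_V' \<alpha> = (\<lambda>(i, j).
     if j = 1 then i
     else length \<alpha> + card {(i', j') \<in> cd \<alpha>. j' \<ge> 2 \<and> (i' > i \<or> i' = i \<and> j' \<le> j)})"

definition filling_X' :: "nat list \<Rightarrow> nat \<times> nat \<Rightarrow> nat" where
  "filling_X' \<alpha> = (\<lambda>(i, j). card {(i', j') \<in> cd \<alpha>. j' < j \<or> j' = j \<and> i' \<le> i})"

definition P_V :: "nat list \<Rightarrow> (nat \<times> nat) set" where
  "P_V \<alpha> =
     interval_poset (sum_list \<alpha>) (read_perm \<alpha> (filling_T \<alpha>)) (read_perm \<alpha> (filling_V' \<alpha>))"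

definition P_X :: "nat list \<Rightarrow> (nat \<times> nat) set" where
  "P_X \<alpha> =
     interval_poset (sum_list \<alpha>) (read_perm \<alpha> (filling_T \<alpha>)) (read_perm \<alpha> (filling_X' \<alpha>))"

section \<open>Posets of box configurations\<close>

text \<open>A pair \<open>(x, y)\<close> is the box in column \<open>x\<close> from the left and row \<open>y\<close> from the bottom.\<close>

definition boxes_enum :: "(nat \<times> nat) set \<Rightarrow> (nat \<times> nat) list" where
  "boxes_enum D =
     concat (map (\<lambda>y. map (\<lambda>x. (x, y)) (sorted_list_of_set {x. (x, y) \<in> D}))
                 (rev (sorted_list_of_set (snd ` D))))"

definition P_D :: "(nat \<times> nat) set \<Rightarrow> (nat \<times> nat) set" where
  "P_D D = {(i, j). i \<in> {1..card D} \<and> j \<in> {1..card D} \<and>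
              fst (boxes_enum D ! (i - 1)) \<le> fst (boxes_enum D ! (j - 1)) \<and>
              snd (boxes_enum D ! (i - 1)) \<le> snd (boxes_enum D ! (j - 1))}"

text \<open>
  For \<open>A = {a\<^sub>1 < \<dots> < a\<^sub>l}\<close> with \<open>A \<subseteq> {1..<n}\<close>, \<open>block n A j\<close> is \<open>{a\<^sub>j\<^sub>-\<^sub>1 + 1..a\<^sub>j}\<close> for
  \<open>1 \<le> j \<le> l + 1\<close>, where \<open>a\<^sub>0 = 0\<close> and \<open>a\<^sub>l\<^sub>+\<^sub>1 = n\<close>.
\<close>

definition block :: "nat \<Rightarrow> nat set \<Rightarrow> nat \<Rightarrow> nat set" where
  "block n A j = (let as = 0 # sorted_list_of_set A @ [n] in {as ! (j - 1) + 1..as ! j})"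

text \<open>The configuration is only defined (is not \<^const>\<open>undefined\<close>) if \<open>w0_comp \<beta>\<close> lies below \<open>\<rho>\<close>.\<close>

definition D_boxes :: "nat list \<Rightarrow> (nat \<Rightarrow> nat) \<Rightarrow> (nat \<times> nat) set" where
  "D_boxes \<beta> \<rho> =
     (let n = sum_list \<beta>; Z = comp_set (comp_compl \<beta>); K = DesL n \<rho> in
      if \<rho> permutes {1..n} \<and> weakL n (w0_comp \<beta>) \<rho>
      then {(i, j). 1 \<le> i \<and> i \<le> card K + 1 \<and> 1 \<le> j \<and> j \<le> card Z + 1 \<and>
                    \<rho> ` block n Z j \<inter> block n K i \<noteq> {}}
      else undefined)"

end

theory Submission
  imports Defs
begin

text \<open>
  The left weak order is inclusion of inversion sets, an inversion being a pair of positions.  Hence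
  \<open>\<gamma>\<close> lies in \<open>[\<sigma>, \<rho>]\<close> iff it orders two positions as \<open>\<sigma>\<close> and \<open>\<rho>\<close> do whenever these two agree,
  and the poset of the interval is the intersection of two linear orders.

  For the intervals at hand the positions are the boxes of the composition diagram in reading order.
  The lower filling numbers the boxes lexicographically by (row, column); the upper one numbers them
  lexicographically by \<open>(x, row)\<close> for a coordinate \<open>x\<close> that increases along rows.  The intersection of
  these two orders is the componentwise order of the points \<open>(x, row)\<close>.  These points are also the
  configuration \<open>D\<close>: its rows are the rows of the diagram, and the descents of the upper reading word
  are the last entries of the classes of boxes with constant \<open>x\<close>, except for the entry \<open>n\<close>.
\<close>

section \<open>Inversions and the left weak order\<close>

text \<open>Several conventions about direction have to fit together. The poset of an interval is
  built from \<open>w0 n \<circ> inv' \<gamma>\<close>, whose inverse is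
  \<open>\<gamma> \<circ> w0 n\<close>; so the label \<open>i\<close> stands for the position
  \<open>n + 1 - i\<close>. The reading order goes through the diagram from the top row down, and
  from right to left in each row, while the configuration is enumerated from its uppermost row down
  and from left to right. Since row \<open>i\<close> from the top of the diagram becomes row
  \<open>i\<close> from the bottom of the configuration, this enumeration is the reading order
  reversed, and the two reversals agree.

  Two objects are given by descriptions that must first be shown to denote something. The poset of
  an interval is unique because a finite poset is determined by its linear extensions: if
  \<open>i\<close> is not below \<open>j\<close>, some extension puts \<open>j\<close> first. The
  configuration is guarded by a comparison with a longest element; the lower reading word is that
  very element, so the guard says that the two ends of the interval are comparable.\<close>

definition inversions :: "nat \<Rightarrow> (nat \<Rightarrow> nat) \<Rightarrow> (nat \<times> nat) set" where
  "inversions n \<sigma> = {(p, q). 1 \<le> p \<and> p < q \<and> q \<le> n \<and> \<sigma> q < \<sigma> p}"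

lemma finite_inversions [simp]: "finite (inversions n \<sigma>)"
  by (rule finite_subset[of _ "{1..n} \<times> {1..n}"]) (auto simp: inversions_def)

lemma inversions_id [simp]: "inversions n id = {}"
  by (auto simp: inversions_def)

lemma simple_refl_permutes: "i \<in> {1..<n} \<Longrightarrow> simple_refl i permutes {1..n}"
  unfolding simple_refl_def by (rule permutes_swap_id) auto

lemma simple_refl_comp_permutes:
  "\<sigma> permutes {1..n} \<Longrightarrow> i \<in> {1..<n} \<Longrightarrow> simple_refl i \<circ> \<sigma> permutes {1..n}"
  by (rule permutes_compose) (auto intro: simple_refl_permutes[simplified])

lemma simple_refl_simple_refl [simp]: "simple_refl i \<circ> (simple_refl i \<circ> \<sigma>) = \<sigma>"
  by (auto simp: simple_refl_def fun_eq_iff)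

lemma inv_simple_refl_comp:
  assumes "\<sigma> permutes {1..n}"
  shows "inv' (simple_refl i \<circ> \<sigma>) = inv' \<sigma> \<circ> simple_refl i"
proof -
  have "inv' (simple_refl i \<circ> \<sigma>) = inv' \<sigma> \<circ> inv' (simple_refl i)"
    using permutes_bij[OF assms] by (intro o_inv_distrib) (auto simp: simple_refl_def)
  then show ?thesis by (simp add: simple_refl_def)
qed

text \<open>Left multiplication by \<open>simple_refl i\<close> exchanges the values
  \<open>i\<close> and \<open>i + 1\<close>. No value lies between them, so only the pair of their
  positions changes its relative order.\<close>

lemma inversions_ascent:
  assumes \<sigma>: "\<sigma> permutes {1..n}" and i: "i \<in> {1..<n}" and asc: "inv' \<sigma> i < inv' \<sigma> (i + 1)"
  shows "inversions n (simple_refl i \<circ> \<sigma>) = insert (inv' \<sigma> i, inv' \<sigma> (i + 1)) (inversions n \<sigma>)"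
    and "(inv' \<sigma> i, inv' \<sigma> (i + 1)) \<notin> inversions n \<sigma>"
proof -
  define p0 q0 where "p0 = inv' \<sigma> i" and "q0 = inv' \<sigma> (i + 1)"
  have p0: "\<And>p. \<sigma> p = i \<longleftrightarrow> p = p0" and q0: "\<And>p. \<sigma> p = i + 1 \<longleftrightarrow> p = q0"
    unfolding p0_def q0_def using permutes_inverses[OF \<sigma>] by metis+
  have "i \<in> {1..n}" "i + 1 \<in> {1..n}" using i by auto
  then have r: "p0 \<in> {1..n}" "q0 \<in> {1..n}" "p0 < q0"
    unfolding p0_def q0_def using permutes_in_image[OF permutes_inv[OF \<sigma>]] asc by blast+
  have *: "(simple_refl i \<circ> \<sigma>) p = (if p = p0 then i + 1 else if p = q0 then i else \<sigma> p)" for p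
    using p0[of p] q0[of p] by (auto simp: simple_refl_def transpose_def)
  have v: "\<sigma> p0 = i" "\<sigma> q0 = i + 1" using p0 q0 by auto
  have "(p, q) \<in> inversions n (simple_refl i \<circ> \<sigma>) \<longleftrightarrow> (p, q) \<in> insert (p0, q0) (inversions n \<sigma>)" for p q
    using r v p0[of p] q0[of p] p0[of q] q0[of q]
    by (cases "p = p0"; cases "p = q0"; cases "q = p0"; cases "q = q0";
        auto simp add: inversions_def * less_Suc_eq simp del: o_apply)
  then show "inversions n (simple_refl i \<circ> \<sigma>) = insert (inv' \<sigma> i, inv' \<sigma> (i + 1)) (inversions n \<sigma>)"
    unfolding p0_def q0_def by auto
  show "(inv' \<sigma> i, inv' \<sigma> (i + 1)) \<notin> inversions n \<sigma>"
    unfolding p0_def[symmetric] q0_def[symmetric] by (simp add: inversions_def v)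
qed

lemma inv_neq_inv_Suc:
  fixes \<sigma> :: "nat \<Rightarrow> nat"
  assumes "\<sigma> permutes {1..n}"
  shows "inv' \<sigma> i \<noteq> inv' \<sigma> (i + 1)"
proof
  assume "inv' \<sigma> i = inv' \<sigma> (i + 1)"
  then have "\<sigma> (inv' \<sigma> i) = \<sigma> (inv' \<sigma> (i + 1))" by (rule arg_cong)
  then have "i = i + 1" by (simp only: permutes_inverses(1)[OF assms])
  then show False by simp
qed

lemma card_inversions_simple_refl:
  assumes \<sigma>: "\<sigma> permutes {1..n}" and i: "i \<in> {1..<n}"
  shows "inv' \<sigma> i < inv' \<sigma> (i + 1) \<Longrightarrow> card (inversions n (simple_refl i \<circ> \<sigma>)) = card (inversions n \<sigma>) + 1"
    and "inv' \<sigma> (i + 1) < inv' \<sigma> i \<Longrightarrow> card (inversions n \<sigma>) = card (inversions n (simple_refl i \<circ> \<sigma>)) + 1"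
proof -
  show "inv' \<sigma> i < inv' \<sigma> (i + 1) \<Longrightarrow> card (inversions n (simple_refl i \<circ> \<sigma>)) = card (inversions n \<sigma>) + 1"
    using inversions_ascent[OF \<sigma> i] by simp
  \<comment> \<open>A descent of \<sigma> is an ascent of \<open>?\<tau>\<close>, and a second
    multiplication by \<open>simple_refl i\<close> leads back to \<sigma>.\<close>
  let ?\<tau> = "simple_refl i \<circ> \<sigma>"
  assume "inv' \<sigma> (i + 1) < inv' \<sigma> i"
  then have "inv' ?\<tau> i < inv' ?\<tau> (i + 1)"
    unfolding inv_simple_refl_comp[OF \<sigma>] by (simp add: simple_refl_def)
  from inversions_ascent[OF simple_refl_comp_permutes[OF \<sigma> i] i this]
  show "card (inversions n \<sigma>) = card (inversions n ?\<tau>) + 1" by simp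
qed

text \<open>Starting from \<open>1 \<le> \<pi> 1\<close>, strict increase gives
  \<open>i \<le> \<pi> i\<close> throughout, which only the identity satisfies.\<close>

lemma increasing_permutation_eq_id:
  assumes \<pi>: "\<pi> permutes {1..n::nat}" and inc: "\<And>i. i \<in> {1..<n} \<Longrightarrow> \<pi> i < \<pi> (i + 1)"
  shows "\<pi> = id"
proof (rule permutes_natset_ge[OF \<pi>], rule ballI)
  show "i \<le> \<pi> i" if "i \<in> {1..n}" for i
    using that
  proof (induction i)
    case (Suc i)
    show ?case
    proof (cases "i = 0")
      case True
      then show ?thesis using permutes_in_image[OF \<pi>, of 1] Suc.prems by auto
    next
      case False
      then show ?thesis using inc[of i] Suc by auto
    qed
  qed simp
qed

text \<open>If no ascent of \<open>\<sigma>\<close> were available, then \<open>\<tau> \<circ> inv' \<sigma>\<close> would be increasing.\<close>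

lemma ascent_below:
  assumes \<sigma>: "\<sigma> permutes {1..n}" and \<tau>: "\<tau> permutes {1..n}"
    and sub: "inversions n \<sigma> \<subseteq> inversions n \<tau>" and "\<sigma> \<noteq> \<tau>"
  obtains i where "i \<in> {1..<n}" "inv' \<sigma> i < inv' \<sigma> (i + 1)" "(inv' \<sigma> i, inv' \<sigma> (i + 1)) \<in> inversions n \<tau>"
proof -
  have "\<exists>i\<in>{1..<n}. inv' \<sigma> i < inv' \<sigma> (i + 1) \<and> (inv' \<sigma> i, inv' \<sigma> (i + 1)) \<in> inversions n \<tau>"
  proof (rule ccontr)
    assume none: "\<not> ?thesis"
    have "\<tau> \<circ> inv' \<sigma> = id"
    proof (rule increasing_permutation_eq_id)
      show "\<tau> \<circ> inv' \<sigma> permutes {1..n}"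
        by (intro permutes_compose permutes_inv \<sigma> \<tau>)
      fix i assume i: "i \<in> {1..<n}"
      have r: "inv' \<sigma> i \<in> {1..n}" "inv' \<sigma> (i + 1) \<in> {1..n}"
        using permutes_in_image[OF permutes_inv[OF \<sigma>]] i by auto
      have ne: "inv' \<sigma> i \<noteq> inv' \<sigma> (i + 1)" by (rule inv_neq_inv_Suc[OF \<sigma>])
      then have "\<tau> (inv' \<sigma> i) \<noteq> \<tau> (inv' \<sigma> (i + 1))"
        using permutes_inj[OF \<tau>] by (auto dest: injD)
      moreover have "\<not> \<tau> (inv' \<sigma> (i + 1)) < \<tau> (inv' \<sigma> i)"
      proof (cases "inv' \<sigma> i < inv' \<sigma> (i + 1)")
        case True
        then show ?thesis using none i r by (auto simp: inversions_def)
      next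
        case False
        then have "(inv' \<sigma> (i + 1), inv' \<sigma> i) \<in> inversions n \<sigma>"
          using r ne by (simp add: inversions_def permutes_inverses[OF \<sigma>])
        then show ?thesis using sub by (auto simp: inversions_def)
      qed
      ultimately show "(\<tau> \<circ> inv' \<sigma>) i < (\<tau> \<circ> inv' \<sigma>) (i + 1)" by simp
    qed
    then have "\<tau> \<circ> inv' \<sigma> \<circ> \<sigma> = \<sigma>" by simp
    then have "\<tau> = \<sigma>" using permutes_inv_o(2)[OF \<sigma>] by (simp add: o_assoc[symmetric])
    then show False using \<open>\<sigma> \<noteq> \<tau>\<close> by simp
  qed
  then show ?thesis using that by blast
qed

text \<open>The cover relation with the comparison of lengths replaced by one of positions. Chains
  of such steps are what identifies the length with the number of inversions, so they cannot be
  phrased through \<open>len\<close> yet; afterwards both relations are shown to be equal.\<close>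

definition ascent_step :: "nat \<Rightarrow> (nat \<Rightarrow> nat) \<Rightarrow> (nat \<Rightarrow> nat) \<Rightarrow> bool" where
  "ascent_step n \<sigma> \<tau> \<longleftrightarrow> \<sigma> permutes {1..n} \<and>
     (\<exists>i\<in>{1..<n}. \<tau> = simple_refl i \<circ> \<sigma> \<and> inv' \<sigma> i < inv' \<sigma> (i + 1))"

text \<open>Greedy ascent: as long as \<sigma> differs from \<tau>, some ascent of \<sigma> adds a
  pair that \<tau> inverts. The inclusion survives and the gap between the two counts shrinks by
  one.\<close>

lemma ascent_steps_if_inversions_subset:
  assumes "\<sigma> permutes {1..n}" and "\<tau> permutes {1..n}" and "inversions n \<sigma> \<subseteq> inversions n \<tau>"
  shows "(ascent_step n)\<^sup>*\<^sup>* \<sigma> \<tau>"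
  using assms
proof (induction "card (inversions n \<tau>) - card (inversions n \<sigma>)" arbitrary: \<sigma> rule: less_induct)
  case less
  show ?case
  proof (cases "\<sigma> = \<tau>")
    case False
    from ascent_below[OF less.prems False] obtain i where
      i: "i \<in> {1..<n}" and asc: "inv' \<sigma> i < inv' \<sigma> (i + 1)"
      and new: "(inv' \<sigma> i, inv' \<sigma> (i + 1)) \<in> inversions n \<tau>"
      by blast
    let ?\<gamma> = "simple_refl i \<circ> \<sigma>"
    note inversions_\<gamma> = inversions_ascent[OF less.prems(1) i asc]
    have sub: "inversions n ?\<gamma> \<subseteq> inversions n \<tau>" using inversions_\<gamma> new less.prems(3) by simp
    then have "card (inversions n ?\<gamma>) \<le> card (inversions n \<tau>)" by (simp add: card_mono)
    then have "card (inversions n \<tau>) - card (inversions n ?\<gamma>) < card (inversions n \<tau>) - card (inversions n \<sigma>)"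
      using inversions_\<gamma> by simp
    then have "(ascent_step n)\<^sup>*\<^sup>* ?\<gamma> \<tau>"
      using less.hyps simple_refl_comp_permutes[OF less.prems(1) i] less.prems(2) sub by blast
    moreover have "ascent_step n \<sigma> ?\<gamma>"
      using less.prems(1) i asc by (auto simp: ascent_step_def)
    ultimately show ?thesis by (simp add: converse_rtranclp_into_rtranclp)
  qed simp
qed

lemma ascent_step_inversions_subset: "ascent_step n \<sigma> \<tau> \<Longrightarrow> inversions n \<sigma> \<subseteq> inversions n \<tau>"
  using inversions_ascent(1) unfolding ascent_step_def by blast

lemma ascent_steps_inversions_subset: "(ascent_step n)\<^sup>*\<^sup>* \<sigma> \<tau> \<Longrightarrow> inversions n \<sigma> \<subseteq> inversions n \<tau>"
  by (induction rule: rtranclp_induct) (auto dest: ascent_step_inversions_subset)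

section \<open>Coxeter length as the number of inversions\<close>

lemma simple_prod_Nil: "simple_prod [] = id"
  by (simp only: simple_prod_def foldr.simps id_apply)

lemma simple_prod_Cons: "simple_prod (i # is) = simple_refl i \<circ> simple_prod is"
  by (simp only: simple_prod_def foldr.simps o_apply)

lemma simple_prod_permutes: "set is \<subseteq> {1..<n} \<Longrightarrow> simple_prod is permutes {1..n}"
proof (induction "is")
  case Nil
  show ?case unfolding simple_prod_Nil by (rule permutes_id)
next
  case (Cons i "is")
  then show ?case unfolding simple_prod_Cons by (intro simple_refl_comp_permutes) auto
qed

text \<open>Each generator changes the number of inversions by exactly one, up or down, so a word is
  at least as long as this number.\<close>

lemma card_inversions_simple_prod: "set is \<subseteq> {1..<n} \<Longrightarrow> card (inversions n (simple_prod is)) \<le> length is"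
proof (induction "is")
  case Nil
  show ?case unfolding simple_prod_Nil inversions_id by simp
next
  case (Cons i "is")
  have \<sigma>: "simple_prod is permutes {1..n}" and i: "i \<in> {1..<n}"
    using Cons.prems simple_prod_permutes by auto
  have "card (inversions n (simple_prod is)) \<le> length is" using Cons by simp
  then show ?case
    unfolding simple_prod_Cons
    using card_inversions_simple_refl[OF \<sigma> i] inv_neq_inv_Suc[OF \<sigma>, of i] length_Cons[of i "is"]
    by (cases "inv' (simple_prod is) i < inv' (simple_prod is) (i + 1)") linarith+
qed

lemma simple_prod_exists:
  assumes "(ascent_step n)\<^sup>*\<^sup>* id \<tau>"
  shows "\<exists>is. length is = card (inversions n \<tau>) \<and> set is \<subseteq> {1..<n} \<and> simple_prod is = \<tau>"
  using assms
proof (induction rule: rtranclp_induct)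
  case base
  show ?case by (rule exI[of _ "[]"]) (simp only: simple_prod_Nil inversions_id, simp)
next
  case (step \<sigma> \<tau>)
  from step.IH obtain "is" where
"is": "length is = card (inversions n \<sigma>)" "set is \<subseteq> {1..<n}" "simple_prod is = \<sigma>"
    by blast
  from step.hyps(2) obtain i where
    i: "i \<in> {1..<n}" "\<tau> = simple_refl i \<circ> \<sigma>" "card (inversions n \<tau>) = card (inversions n \<sigma>) + 1"
    using card_inversions_simple_refl(1) unfolding ascent_step_def by blast
  have "simple_prod (i # is) = \<tau>" using "is" i(2) by (simp only: simple_prod_Cons)
  then show ?case using "is"(1,2) i(1,3) by (intro exI[of _ "i # is"]) simp
qed

text \<open>Since \<open>id\<close> has no inversions, a chain of ascents leads from it to \<sigma>;
  its word attains the lower bound valid for all words.\<close>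

lemma len_eq_card_inversions:
  assumes "\<sigma> permutes {1..n}"
  shows "len n \<sigma> = card (inversions n \<sigma>)"
  unfolding len_def
proof (rule Least_equality)
  show "\<exists>is. length is = card (inversions n \<sigma>) \<and> set is \<subseteq> {1..<n} \<and> simple_prod is = \<sigma>"
    using ascent_steps_if_inversions_subset[OF permutes_id assms] by (intro simple_prod_exists) simp
qed (use card_inversions_simple_prod in blast)

section \<open>Descents, covers and the weak order in terms of positions\<close>

lemma DesL_eq:
  assumes \<sigma>: "\<sigma> permutes {1..n}"
  shows "DesL n \<sigma> = {i \<in> {1..<n}. inv' \<sigma> (i + 1) < inv' \<sigma> i}"
proof -
  have "len n (simple_refl i \<circ> \<sigma>) < len n \<sigma> \<longleftrightarrow> inv' \<sigma> (i + 1) < inv' \<sigma> i"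
    if "i \<in> {1..<n}" for i
    unfolding len_eq_card_inversions[OF \<sigma>] len_eq_card_inversions[OF simple_refl_comp_permutes[OF \<sigma> that]]
    using card_inversions_simple_refl[OF \<sigma> that] inv_neq_inv_Suc[OF \<sigma>, of i] by linarith
  then show ?thesis by (auto simp: DesL_def)
qed

lemma weakL_cover_eq_ascent_step: "weakL_cover n = ascent_step n"
proof -
  have "len n \<sigma> < len n (simple_refl i \<circ> \<sigma>) \<longleftrightarrow> inv' \<sigma> i < inv' \<sigma> (i + 1)"
    if \<sigma>: "\<sigma> permutes {1..n}" and "i \<in> {1..<n}" for i \<sigma>
    unfolding len_eq_card_inversions[OF \<sigma>] len_eq_card_inversions[OF simple_refl_comp_permutes[OF that]]
    using card_inversions_simple_refl[OF that] inv_neq_inv_Suc[OF \<sigma>, of i] by linarith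
  then show ?thesis unfolding weakL_cover_def ascent_step_def by (intro ext) blast
qed

lemma weakL_iff_inversions_subset:
  assumes "\<sigma> permutes {1..n}" and "\<tau> permutes {1..n}"
  shows "weakL n \<sigma> \<tau> \<longleftrightarrow> inversions n \<sigma> \<subseteq> inversions n \<tau>"
  unfolding weakL_def weakL_cover_eq_ascent_step
  using assms ascent_steps_inversions_subset ascent_steps_if_inversions_subset by blast

lemma inversions_inject:
  assumes "\<sigma> permutes {1..n}" and "\<tau> permutes {1..n}" and "inversions n \<sigma> = inversions n \<tau>"
  shows "\<sigma> = \<tau>"
proof (rule ccontr)
  assume "\<sigma> \<noteq> \<tau>"
  with assms obtain i where "i \<in> {1..<n}" "inv' \<sigma> i < inv' \<sigma> (i + 1)"
    "(inv' \<sigma> i, inv' \<sigma> (i + 1)) \<in> inversions n \<tau>"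
    using ascent_below[of \<sigma> n \<tau>] by blast
  then show False using inversions_ascent(2)[OF assms(1)] assms(3) by blast
qed

text \<open>Maximality with respect to inclusion, not just cardinality, yields the uniqueness that
  \<open>THE\<close> demands: an element of equal length has the same inversion set and is therefore
  the same permutation.\<close>

lemma longest_elem_eq:
  assumes W: "\<And>v. v \<in> W \<Longrightarrow> v permutes {1..n}" and w: "w \<in> W"
    and max: "\<And>v. v \<in> W \<Longrightarrow> inversions n v \<subseteq> inversions n w"
  shows "longest_elem n W = w"
  unfolding longest_elem_def
proof (rule the_equality)
  have "len n v \<le> len n w" if "v \<in> W" for v
    unfolding len_eq_card_inversions[OF W[OF that]] len_eq_card_inversions[OF W[OF w]]
    by (rule card_mono[OF finite_inversions max[OF that]])
  then show "w \<in> W \<and> (\<forall>v\<in>W. len n v \<le> len n w)" using w by blast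
  fix v assume v: "v \<in> W \<and> (\<forall>u\<in>W. len n u \<le> len n v)"
  then have "len n w \<le> len n v" using w by blast
  then have "card (inversions n w) \<le> card (inversions n v)"
    using v unfolding len_eq_card_inversions[OF W[OF w]] by (simp only: len_eq_card_inversions[OF W])
  then have "inversions n v = inversions n w" using max v by (intro card_seteq[OF finite_inversions]) blast+
  then show "v = w" using inversions_inject W v w by blast
qed

lemma w0_eq: "w0 n = (\<lambda>i. if i \<in> {1..n} then n + 1 - i else i)" (is "_ = ?r")
  unfolding w0_def
proof (rule longest_elem_eq)
  have "bij_betw ?r {1..n} {1..n}" by (rule bij_betwI[of _ _ _ ?r]) auto
  then have "?r permutes {1..n}" by (rule bij_imp_permutes) auto
  then show "?r \<in> carrier (sym_group n)" by (simp add: sym_group_carrier)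
  show "v permutes {1..n}" if "v \<in> carrier (sym_group n)" for v
    using that by (simp add: sym_group_carrier)
  show "inversions n v \<subseteq> inversions n ?r" for v by (auto simp: inversions_def)
qed

section \<open>The poset of an interval\<close>

text \<open>Topological sorting: a minimal element goes first, and the remaining elements are sorted
  by induction.\<close>

lemma linear_extension_list:
  assumes "finite A" and "antisym P" and "trans P"
  obtains xs where "set xs = A" "distinct xs" "sorted_wrt (\<lambda>x y. (y, x) \<notin> P) xs"
proof -
  have "\<exists>xs. set xs = A \<and> distinct xs \<and> sorted_wrt (\<lambda>x y. (y, x) \<notin> P) xs"
    using \<open>finite A\<close>
  proof (induction A rule: finite_psubset_induct)
    case (psubset A)
    show ?case
    proof (cases "A = {}")
      case False
      let ?r = "\<lambda>x y. (x, y) \<in> P \<and> x \<noteq> y"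
      have "asymp_on A ?r" "transp_on A ?r"
        using antisymD[OF assms(2)] transD[OF assms(3)]
        by (auto intro!: asymp_onI transp_onI)
      then obtain m where m: "m \<in> A" "\<And>x. x \<in> A \<Longrightarrow> x \<noteq> m \<Longrightarrow> (x, m) \<notin> P"
        using Finite_Set.bex_min_element[OF psubset.hyps(1), of ?r] False by auto
      have "A - {m} \<subset> A" using m by blast
      then obtain xs where "set xs = A - {m}" "distinct xs" "sorted_wrt (\<lambda>x y. (y, x) \<notin> P) xs"
        using psubset.IH by blast
      then show ?thesis using m by (intro exI[of _ "m # xs"]) auto
    qed simp
  qed
  then show ?thesis using that by blast
qed

text \<open>The nontrivial half of the fact that a finite poset is the intersection of its linear
  extensions.\<close>

lemma SigmaR_separates:
  assumes P: "partial_order_on {1..n} P" and ij: "i \<in> {1..n}" "j \<in> {1..n}" "i \<noteq> j" "(i, j) \<notin> P"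
  obtains \<sigma> where "\<sigma> \<in> SigmaR n P" "inv' \<sigma> j < inv' \<sigma> i"
proof -
  have refl: "\<And>x. x \<in> {1..n} \<Longrightarrow> (x, x) \<in> P" and field: "P \<subseteq> {1..n} \<times> {1..n}"
    and anti: "antisym P" and trans: "trans P"
    using P by (auto simp: partial_order_on_def preorder_on_def refl_on_def)
  \<comment> \<open>This is the transitive closure of \<open>P\<close> with \<open>(j, i)\<close>
    added: a path through the new pair starts below \<open>j\<close> and ends above
    \<open>i\<close>. A cycle would force \<open>(i, j) \<in> P\<close>.\<close>
  let ?Q = "P \<union> {(a, b). (a, j) \<in> P \<and> (i, b) \<in> P}"
  have "antisym ?Q"
    using antisymD[OF anti] transD[OF trans] ij(4) unfolding antisym_def by blast
  moreover have "trans ?Q"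
    using transD[OF trans] ij(4) unfolding trans_def by blast
  ultimately obtain xs where xs: "set xs = {1..n}" "distinct xs"
      "sorted_wrt (\<lambda>x y. (y, x) \<notin> ?Q) xs"
    using linear_extension_list[of "{1..n}" ?Q] by auto
  have length: "length xs = n" using distinct_card[OF xs(2)] xs(1) by simp
  define \<sigma> where "\<sigma> = perm_of_word xs"
  have nth: "\<sigma> p = xs ! (p - 1)" if "p \<in> {1..n}" for p
    using that length by (simp add: \<sigma>_def perm_of_word_def)
  have "bij_betw \<sigma> {1..n} {1..n}"
  proof -
    have "bij_betw (\<lambda>p. p - 1) {1..n} {..<n}"
      by (rule bij_betwI[of _ _ _ "\<lambda>p. p + 1"]) auto
    moreover have "bij_betw ((!) xs) {..<n} {1..n}"
      using bij_betw_nth[OF xs(2)] xs(1) length by simp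
    ultimately have "bij_betw ((!) xs \<circ> (\<lambda>p. p - 1)) {1..n} {1..n}" by (rule bij_betw_trans)
    then show ?thesis by (rule bij_betw_cong[THEN iffD1, rotated]) (simp add: nth)
  qed
  then have perm: "\<sigma> permutes {1..n}"
    by (rule bij_imp_permutes) (auto simp: \<sigma>_def perm_of_word_def length)
  have "inv' \<sigma> a < inv' \<sigma> b" if ab: "(a, b) \<in> ?Q" "a \<noteq> b" for a b
  proof (rule ccontr)
    assume "\<not> ?thesis"
    moreover have "inv' \<sigma> a \<noteq> inv' \<sigma> b"
      using ab(2) injD[OF permutes_inj[OF permutes_inv[OF perm]]] by blast
    moreover have "a \<in> {1..n}" "b \<in> {1..n}" using field ab by auto
    then have "inv' \<sigma> a \<in> {1..n}" "inv' \<sigma> b \<in> {1..n}"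
      using permutes_in_image[OF permutes_inv[OF perm]] by blast+
    ultimately have "(\<sigma> (inv' \<sigma> a), \<sigma> (inv' \<sigma> b)) \<notin> ?Q"
      using sorted_wrt_nth_less[OF xs(3), of "inv' \<sigma> b - 1" "inv' \<sigma> a - 1"] length nth by auto
    then show False using ab permutes_inverses(1)[OF perm] by simp
  qed
  moreover have "(j, i) \<in> ?Q" using ij refl by auto
  ultimately have "\<sigma> \<in> SigmaR n P" "inv' \<sigma> j < inv' \<sigma> i"
    using perm ij(3) by (auto simp: SigmaR_def)
  then show ?thesis using that by blast
qed

text \<open>Any rival \<open>Q\<close> has the same linear extensions as \<open>P\<close>. A pair
  missing from one of the two posets is reversed by some extension, hence missing from the other as
  well.\<close>

lemma interval_poset_eqI:
  assumes P: "partial_order_on {1..n} P"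
    and SigmaR: "SigmaR n P = (\<lambda>\<gamma>. w0 n \<circ> inv' \<gamma>) ` weakL_interval n \<sigma> \<rho>"
  shows "interval_poset n \<sigma> \<rho> = P"
  unfolding interval_poset_def
proof (rule the_equality)
  fix Q assume Q: "partial_order_on {1..n} Q \<and>
      SigmaR n Q = (\<lambda>\<gamma>. w0 n \<circ> inv' \<gamma>) ` weakL_interval n \<sigma> \<rho>"
  have sub: "P \<subseteq> Q" if P: "partial_order_on {1..n} P" and Q: "partial_order_on {1..n} Q"
    and eq: "SigmaR n P = SigmaR n Q" for P Q
  proof (rule subrelI)
    fix i j assume "(i, j) \<in> P"
    then have ij: "i \<in> {1..n}" "j \<in> {1..n}"
      using P by (auto simp: partial_order_on_def preorder_on_def refl_on_def)
    have refl: "(i, i) \<in> Q"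
      using ij Q by (simp add: partial_order_on_def preorder_on_def refl_on_def)
    show "(i, j) \<in> Q"
    proof (cases "i = j")
      case True
      then show ?thesis using refl by simp
    next
      case False
      show ?thesis
      proof (rule ccontr)
        assume "(i, j) \<notin> Q"
        then obtain \<sigma> where "\<sigma> \<in> SigmaR n P" "inv' \<sigma> j < inv' \<sigma> i"
          using SigmaR_separates[OF Q ij False] unfolding eq by blast
        then show False using \<open>(i, j) \<in> P\<close> False by (force simp: SigmaR_def)
      qed
    qed
  qed
  show "Q = P" using sub[of P Q] sub[of Q P] P Q SigmaR by auto
qed (use assms in blast)

lemma interval_poset_eq:
  assumes \<sigma>: "\<sigma> permutes {1..n}" and \<rho>: "\<rho> permutes {1..n}" and le: "inversions n \<sigma> \<subseteq> inversions n \<rho>"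
  shows "interval_poset n \<sigma> \<rho> = {(i, j). i \<in> {1..n} \<and> j \<in> {1..n} \<and>
           \<sigma> (n + 1 - i) \<le> \<sigma> (n + 1 - j) \<and> \<rho> (n + 1 - i) \<le> \<rho> (n + 1 - j)}" (is "_ = ?P")
proof (rule interval_poset_eqI)
  have inj: "n + 1 - i = n + 1 - j \<longleftrightarrow> i = j" if "i \<in> {1..n}" "j \<in> {1..n}" for i j
    using that by auto
  show "partial_order_on {1..n} ?P"
    unfolding partial_order_on_def preorder_on_def
  proof (intro conjI)
    show "antisym ?P"
    proof (rule antisymI)
      fix i j assume "(i, j) \<in> ?P" "(j, i) \<in> ?P"
      then have "\<sigma> (n + 1 - i) = \<sigma> (n + 1 - j)" "i \<in> {1..n}" "j \<in> {1..n}" by auto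
      then show "i = j" using injD[OF permutes_inj[OF \<sigma>]] inj by blast
    qed
  qed (auto simp: refl_on_def trans_def)
  have w0_w0: "w0 n (w0 n i) = i" for i by (auto simp: w0_eq)
  have w0_perm: "w0 n permutes {1..n}"
    by (rule bij_imp_permutes, rule bij_betwI[of _ _ _ "w0 n"]) (auto simp: w0_eq)
  show "SigmaR n ?P = (\<lambda>\<gamma>. w0 n \<circ> inv' \<gamma>) ` weakL_interval n \<sigma> \<rho>"
  proof (rule Set.set_eqI)
    fix \<tau>
    have *: "\<tau> \<in> SigmaR n ?P \<longleftrightarrow> inv' \<tau> \<circ> w0 n \<in> weakL_interval n \<sigma> \<rho>" if \<tau>: "\<tau> permutes {1..n}"
    proof -
      define \<gamma> where "\<gamma> = inv' \<tau> \<circ> w0 n"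
      have \<gamma>: "\<gamma> permutes {1..n}"
        unfolding \<gamma>_def by (intro permutes_compose w0_perm permutes_inv \<tau>)
      have inj\<sigma>: "\<sigma> p = \<sigma> q \<longleftrightarrow> p = q" and inj\<rho>: "\<rho> p = \<rho> q \<longleftrightarrow> p = q"
        and inj\<gamma>: "\<gamma> p = \<gamma> q \<longleftrightarrow> p = q" for p q
        using permutes_inj[OF \<sigma>] permutes_inj[OF \<rho>] permutes_inj[OF \<gamma>]
        by (simp_all add: inj_eq)
      have at: "\<gamma> (n + 1 - i) = inv' \<tau> i" if "i \<in> {1..n}" for i
        using that by (auto simp: w0_eq \<gamma>_def)
      have "\<tau> \<in> SigmaR n ?P \<longleftrightarrow> (\<forall>i j. (i, j) \<in> ?P \<and> i \<noteq> j \<longrightarrow> inv' \<tau> i < inv' \<tau> j)"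
        using \<tau> unfolding SigmaR_def mem_Collect_eq by blast
      also have "\<dots> \<longleftrightarrow>
          (\<forall>i j. (i, j) \<in> ?P \<and> i \<noteq> j \<longrightarrow> \<gamma> (n + 1 - i) < \<gamma> (n + 1 - j))"
      proof (intro iff_allI imp_cong refl)
        fix i j assume "(i, j) \<in> ?P \<and> i \<noteq> j"
        then show "inv' \<tau> i < inv' \<tau> j \<longleftrightarrow> \<gamma> (n + 1 - i) < \<gamma> (n + 1 - j)"
          using at[of i] at[of j] by simp
      qed
      also have "\<dots> \<longleftrightarrow> (\<forall>p\<in>{1..n}. \<forall>q\<in>{1..n}. \<sigma> p < \<sigma> q \<and> \<rho> p < \<rho> q \<longrightarrow> \<gamma> p < \<gamma> q)"
        (is "?L \<longleftrightarrow> ?R")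
      proof (intro iffI ballI impI allI)
        fix p q assume L: ?L and "p \<in> {1..n}" "q \<in> {1..n}" "\<sigma> p < \<sigma> q \<and> \<rho> p < \<rho> q"
        then show "\<gamma> p < \<gamma> q"
          using L[rule_format, of "n + 1 - p" "n + 1 - q"] by force
      next
        fix i j assume R: ?R and ij: "(i, j) \<in> ?P \<and> i \<noteq> j"
        then have "n + 1 - i \<noteq> n + 1 - j" by auto
        then have "\<sigma> (n + 1 - i) \<noteq> \<sigma> (n + 1 - j)" "\<rho> (n + 1 - i) \<noteq> \<rho> (n + 1 - j)"
          by (simp_all only: inj\<sigma> inj\<rho> not_False_eq_True)
        then show "\<gamma> (n + 1 - i) < \<gamma> (n + 1 - j)"
          using ij by (intro R[rule_format]) auto
      qed
      also have "\<dots> \<longleftrightarrow> inversions n \<sigma> \<subseteq> inversions n \<gamma> \<and> inversions n \<gamma> \<subseteq> inversions n \<rho>"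
      proof (intro iffI conjI subrelI ballI impI)
        fix p q assume R: ?R
        \<comment> \<open>By \<open>le\<close> the permutation \<rho> inverts this pair too, so
          \<sigma> and \<rho> agree on it and \<gamma> has to follow.\<close>
        { assume "(p, q) \<in> inversions n \<sigma>"
          then show "(p, q) \<in> inversions n \<gamma>"
            using R[rule_format, of q p] le by (auto simp: inversions_def) }
        { assume pq: "(p, q) \<in> inversions n \<gamma>"
          show "(p, q) \<in> inversions n \<rho>"
          proof (rule ccontr)
            \<comment> \<open>By \<open>le\<close> a pair that \<rho> leaves in order is also left
              in order by \<sigma>, so \<gamma> could not invert it.\<close>
            assume "(p, q) \<notin> inversions n \<rho>"
            then have "\<not> \<rho> q < \<rho> p" "\<not> \<sigma> q < \<sigma> p" "p \<in> {1..n}" "q \<in> {1..n}" "p < q"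
              using pq le by (auto simp: inversions_def)
            then have "\<gamma> p < \<gamma> q"
              using inj\<sigma>[of p q] inj\<rho>[of p q] by (intro R[rule_format]) auto
            then show False using pq by (auto simp: inversions_def)
          qed }
      next
        fix p q assume sub: "inversions n \<sigma> \<subseteq> inversions n \<gamma> \<and> inversions n \<gamma> \<subseteq> inversions n \<rho>"
          and pq: "p \<in> {1..n}" "q \<in> {1..n}" "\<sigma> p < \<sigma> q \<and> \<rho> p < \<rho> q"
        show "\<gamma> p < \<gamma> q"
        proof (cases "p < q")
          case True
          then have "(p, q) \<notin> inversions n \<gamma>" using sub pq by (auto simp: inversions_def)
          then show ?thesis using True pq inj\<gamma>[of p q] by (auto simp: inversions_def)
        next
          case False
          then have "(q, p) \<in> inversions n \<sigma>"
            using pq by (auto simp: inversions_def not_less le_less)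
          then have "(q, p) \<in> inversions n \<gamma>" using sub by blast
          then show ?thesis by (simp add: inversions_def)
        qed
      qed
      also have "\<dots> \<longleftrightarrow> \<gamma> \<in> weakL_interval n \<sigma> \<rho>"
        using \<gamma> \<sigma> \<rho> by (simp add: weakL_interval_def weakL_iff_inversions_subset)
      finally show ?thesis unfolding \<gamma>_def .
    qed
    \<comment> \<open>As \<open>w0 n\<close> is an involution, \<gamma> and \<tau> determine each
      other: \<open>\<tau> = w0 n \<circ> inv' \<gamma>\<close> holds exactly if
      \<open>\<gamma> = inv' \<tau> \<circ> w0 n\<close>. This equation and the next are the two
      round trips.\<close>
    have inv_eq: "w0 n \<circ> inv' (inv' \<tau> \<circ> w0 n) = \<tau>" if "\<tau> permutes {1..n}"
    proof -
      have "inv' (inv' \<tau> \<circ> w0 n) = inv' (w0 n) \<circ> \<tau>"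
        using permutes_bij[OF that] permutes_bij[OF w0_perm]
        by (simp add: o_inv_distrib bij_imp_bij_inv inv_inv_eq)
      moreover have "inv' (w0 n) = w0 n" using w0_w0 by (intro inv_equality)
      ultimately show ?thesis by (simp add: fun_eq_iff w0_w0)
    qed
    have inv_eq': "inv' (w0 n \<circ> inv' \<gamma>) \<circ> w0 n = \<gamma>" "w0 n \<circ> inv' \<gamma> permutes {1..n}"
      if "\<gamma> permutes {1..n}" for \<gamma>
    proof -
      have "inv' (w0 n \<circ> inv' \<gamma>) = \<gamma> \<circ> inv' (w0 n)"
        using permutes_bij[OF that] permutes_bij[OF w0_perm]
        by (simp add: o_inv_distrib bij_imp_bij_inv inv_inv_eq)
      moreover have "inv' (w0 n) = w0 n" using w0_w0 by (intro inv_equality)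
      ultimately show "inv' (w0 n \<circ> inv' \<gamma>) \<circ> w0 n = \<gamma>" by (simp add: fun_eq_iff w0_w0)
      show "w0 n \<circ> inv' \<gamma> permutes {1..n}" by (intro permutes_compose w0_perm permutes_inv that)
    qed
    show "\<tau> \<in> SigmaR n ?P \<longleftrightarrow> \<tau> \<in> (\<lambda>\<gamma>. w0 n \<circ> inv' \<gamma>) ` weakL_interval n \<sigma> \<rho>"
    proof
      assume "\<tau> \<in> SigmaR n ?P"
      moreover from this have "\<tau> permutes {1..n}" by (simp add: SigmaR_def)
      ultimately show "\<tau> \<in> (\<lambda>\<gamma>. w0 n \<circ> inv' \<gamma>) ` weakL_interval n \<sigma> \<rho>"
        using * inv_eq by (intro image_eqI[of _ _ "inv' \<tau> \<circ> w0 n"]) simp_all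
    next
      assume "\<tau> \<in> (\<lambda>\<gamma>. w0 n \<circ> inv' \<gamma>) ` weakL_interval n \<sigma> \<rho>"
      then obtain \<gamma> where "\<gamma> \<in> weakL_interval n \<sigma> \<rho>" "\<tau> = w0 n \<circ> inv' \<gamma>" by blast
      then show "\<tau> \<in> SigmaR n ?P"
        using * inv_eq' by (simp add: weakL_interval_def)
    qed
  qed
qed

section \<open>Compositions\<close>

text \<open>The total is excluded from the set of a composition, and appending a part turns the old
  total into a proper partial sum. This is why compositions are treated by induction from the
  right.\<close>

lemma comp_set_snoc: "comp_set (\<beta> @ [a]) = (if \<beta> = [] then {} else insert (sum_list \<beta>) (comp_set \<beta>))"
proof -
  have "comp_set (\<beta> @ [a]) = (\<lambda>k. sum_list (take k \<beta>)) ` {1..length \<beta>}"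
    by (force simp: comp_set_def image_iff)
  moreover have "comp_set \<beta> = (\<lambda>k. sum_list (take k \<beta>)) ` {1..<length \<beta>}"
    by (force simp: comp_set_def image_iff)
  moreover have "{1..length \<beta>} = (if \<beta> = [] then {} else insert (length \<beta>) {1..<length \<beta>})"
    by (cases \<beta>) auto
  ultimately show ?thesis by simp
qed

lemma comp_set_Nil [simp]: "comp_set [] = {}"
  by (simp add: comp_set_def)

lemma composition_of_Nil [simp]: "composition_of n [] \<longleftrightarrow> n = 0"
  by (auto simp: composition_of_def)

lemma composition_of_snoc:
  "composition_of n (\<alpha> @ [a]) \<longleftrightarrow> 1 \<le> a \<and> composition_of (sum_list \<alpha>) \<alpha> \<and> n = sum_list \<alpha> + a"
  by (auto simp: composition_of_def)

lemma composition_of_0: "composition_of 0 \<alpha> \<longleftrightarrow> \<alpha> = []"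
  by (cases \<alpha> rule: rev_cases) (auto simp: composition_of_snoc)

lemma comp_set_subset: "composition_of n \<alpha> \<Longrightarrow> comp_set \<alpha> \<subseteq> {1..<n}"
proof (induction \<alpha> arbitrary: n rule: rev_induct)
  case (snoc a \<alpha>)
  then have IH: "comp_set \<alpha> \<subseteq> {1..<sum_list \<alpha>}" and a: "1 \<le> a" "n = sum_list \<alpha> + a"
    by (auto simp: composition_of_snoc)
  have "1 \<le> sum_list \<alpha>" if "\<alpha> \<noteq> []"
    using snoc.prems that composition_of_0[of \<alpha>] by (cases "sum_list \<alpha>") (auto simp: composition_of_snoc)
  then show ?case using IH a by (auto simp: comp_set_snoc)
qed simp

text \<open>A composition of \<open>n\<close> is extended to one of \<open>Suc n\<close> in two
  ways: a new part 1 makes \<open>n\<close> a partial sum, while enlarging the last part by 1 does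
  not.\<close>

lemma composition_exists: "S \<subseteq> {1..<n} \<Longrightarrow> \<exists>\<beta>. composition_of n \<beta> \<and> comp_set \<beta> = S"
proof (induction n arbitrary: S)
  case 0
  then show ?case by (intro exI[of _ "[]"]) simp
next
  case (Suc n)
  have "S - {n} \<subseteq> {1..<n}" using Suc.prems by auto
  then obtain \<beta> where \<beta>: "composition_of n \<beta>" "comp_set \<beta> = S - {n}"
    using Suc.IH by blast
  have sum: "sum_list \<beta> = n" using \<beta>(1) by (simp add: composition_of_def)
  show ?case
  proof (cases "\<beta> = []")
    case True
    then have "n = 0" "S = {}" using \<beta> Suc.prems by auto
    then show ?thesis
      by (intro exI[of _ "[1]"]) (simp add: composition_of_def comp_set_snoc[of "[]", simplified])
  next
    case False
    show ?thesis
    proof (cases "n \<in> S")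
      case True
      then show ?thesis using \<beta> sum False
        by (intro exI[of _ "\<beta> @ [1]"]) (auto simp: composition_of_snoc comp_set_snoc)
    next
      case n: False
      obtain \<gamma> a where "\<beta> = \<gamma> @ [a]" using False by (cases \<beta> rule: rev_cases) auto
      then show ?thesis using \<beta> n
        by (intro exI[of _ "\<gamma> @ [a + 1]"]) (auto simp: composition_of_snoc comp_set_snoc)
    qed
  qed
qed

text \<open>If there is more than one part, the sum of all parts but the last is the maximum of the
  set. So the set determines the last part, and removing the maximum leaves the set of the shorter
  composition.\<close>

lemma comp_set_inject:
  "composition_of n \<alpha> \<Longrightarrow> composition_of n \<beta> \<Longrightarrow> comp_set \<alpha> = comp_set \<beta> \<Longrightarrow> \<alpha> = \<beta>"
proof (induction \<alpha> arbitrary: \<beta> n rule: rev_induct)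
  case Nil
  then show ?case by (simp add: composition_of_0)
next
  case (snoc a \<alpha>)
  obtain \<gamma> b where \<beta>: "\<beta> = \<gamma> @ [b]"
    using snoc.prems by (cases \<beta> rule: rev_cases) (auto simp: composition_of_snoc)
  have comp: "composition_of (sum_list \<alpha>) \<alpha>" "composition_of (sum_list \<gamma>) \<gamma>"
    and n: "n = sum_list \<alpha> + a" "n = sum_list \<gamma> + b"
    using snoc.prems by (auto simp: \<beta> composition_of_snoc)
  have sub: "comp_set \<alpha> \<subseteq> {1..<sum_list \<alpha>}" "comp_set \<gamma> \<subseteq> {1..<sum_list \<gamma>}"
    using comp by (simp_all only: comp_set_subset)
  show ?case
  proof (cases "\<alpha> = [] \<or> \<gamma> = []")
    case True
    then have "\<alpha> = []" "\<gamma> = []"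
      using snoc.prems(3) by (auto simp: \<beta> comp_set_snoc split: if_splits)
    then show ?thesis using n \<beta> by simp
  next
    case False
    then have eq: "insert (sum_list \<alpha>) (comp_set \<alpha>) = insert (sum_list \<gamma>) (comp_set \<gamma>)"
      using snoc.prems(3) by (simp add: \<beta> comp_set_snoc)
    then have "sum_list \<alpha> \<in> insert (sum_list \<gamma>) (comp_set \<gamma>)"
      and "sum_list \<gamma> \<in> insert (sum_list \<alpha>) (comp_set \<alpha>)" by blast+
    then have sum: "sum_list \<alpha> = sum_list \<gamma>" using sub by force
    have "sum_list \<alpha> \<notin> comp_set \<alpha>" "sum_list \<alpha> \<notin> comp_set \<gamma>" using sub sum by auto
    then have "comp_set \<alpha> = comp_set \<gamma>" using eq sum by (simp add: insert_ident)
    then show ?thesis using snoc.IH comp sum n \<beta> by auto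
  qed
qed

lemma comp_compl:
  assumes "composition_of n \<alpha>"
  shows "composition_of n (comp_compl \<alpha>)" and "comp_set (comp_compl \<alpha>) = {1..<n} - comp_set \<alpha>"
proof -
  have sum: "sum_list \<alpha> = n" using assms by (simp add: composition_of_def)
  have "\<exists>!\<beta>. composition_of n \<beta> \<and> comp_set \<beta> = {1..<n} - comp_set \<alpha>"
    using composition_exists[of "{1..<n} - comp_set \<alpha>" n] comp_set_inject by auto
  from theI'[OF this]
  show "composition_of n (comp_compl \<alpha>)" "comp_set (comp_compl \<alpha>) = {1..<n} - comp_set \<alpha>"
    unfolding comp_compl_def sum by blast+
qed

lemma comp_compl_comp_compl: "composition_of n \<alpha> \<Longrightarrow> comp_compl (comp_compl \<alpha>) = \<alpha>"
  using comp_compl[of n \<alpha>] comp_compl[of n "comp_compl \<alpha>"] comp_set_subset[of n \<alpha>]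
  by (intro comp_set_inject[of n]) auto

section \<open>Blocks\<close>

text \<open>In a strictly increasing list the elements below \<open>v\<close> form an initial
  segment; indices count from 0, so index \<open>t\<close> belongs to it when the segment has more
  than \<open>t\<close> elements.\<close>

lemma less_card_less_iff:
  fixes s :: "'a::linorder list"
  assumes "sorted_wrt (<) s" and "t < length s"
  shows "t < card {a \<in> set s. a < v} \<longleftrightarrow> s ! t < v"
proof
  have inj: "inj_on ((!) s) {..t}"
    using assms by (auto simp: inj_on_nth strict_sorted_iff)
  assume "s ! t < v"
  moreover have "s ! j \<le> s ! t" if "j \<le> t" for j
    using sorted_wrt_nth_less[OF assms(1), of j t] that assms(2) by (cases "j = t") auto
  ultimately have "(!) s ` {..t} \<subseteq> {a \<in> set s. a < v}"
    using assms(2) by (fastforce intro: nth_mem)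
  then have "card ((!) s ` {..t}) \<le> card {a \<in> set s. a < v}" by (intro card_mono) auto
  then show "t < card {a \<in> set s. a < v}" by (simp add: card_image[OF inj])
next
  assume less: "t < card {a \<in> set s. a < v}"
  show "s ! t < v"
  proof (rule ccontr)
    assume ge: "\<not> s ! t < v"
    have "{a \<in> set s. a < v} \<subseteq> (!) s ` {..<t}"
    proof
      fix a assume "a \<in> {a \<in> set s. a < v}"
      then obtain j where j: "j < length s" "a = s ! j" "s ! j < v" by (auto simp: in_set_conv_nth)
      have "j < t"
        using sorted_wrt_nth_less[OF assms(1), of t j] j ge by (cases j t rule: linorder_cases) auto
      then show "a \<in> (!) s ` {..<t}" using j by auto
    qed
    then have "card {a \<in> set s. a < v} \<le> card ((!) s ` {..<t})" by (intro card_mono) auto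
    also have "\<dots> \<le> t" using card_image_le[of "{..<t}" "(!) s"] by simp
    finally show False using less by simp
  qed
qed

text \<open>Replaces list lookups by counting, the form in which rows and columns of boxes are
  computed later. The count is strict because a breakpoint is the last element of its block.\<close>

lemma block_iff:
  assumes A: "A \<subseteq> {1..<n}" and i: "1 \<le> i" "i \<le> card A + 1"
  shows "v \<in> block n A i \<longleftrightarrow> v \<in> {1..n} \<and> i = 1 + card {a \<in> A. a < v}"
proof -
  define s where "s = sorted_list_of_set A"
  have fin: "finite A" using A by (rule finite_subset) simp
  then have s: "sorted_wrt (<) s" "set s = A" "length s = card A"
    by (auto simp: s_def)
  have le: "card {a \<in> A. a < v} \<le> length s" for v
    unfolding s(3) using fin by (intro card_mono) auto
  have *: "t < card {a \<in> A. a < v} \<longleftrightarrow> s ! t < v" if "t < length s" for t v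
    using less_card_less_iff[OF s(1) that] by (simp add: s(2))
  \<comment> \<open>The leading 0 shifts indices: for \<open>i \<ge> 2\<close> the lower end of
    block \<open>i\<close> comes from \<open>s ! (i - 2)\<close>. Its upper end is
    \<open>s ! (i - 1)\<close>, except for the last block, which ends at \<open>n\<close>.\<close>
  have lower: "(0 # s @ [n]) ! (i - 1) + 1 \<le> v \<longleftrightarrow> 1 \<le> v \<and> i \<le> 1 + card {a \<in> A. a < v}"
  proof (cases "i = 1")
    case False
    then have t: "i - 2 < length s" "i - 1 = Suc (i - 2)" using i s(3) by auto
    then have "(0 # s @ [n]) ! (i - 1) = s ! (i - 2)"
      unfolding t(2) nth_Cons_Suc by (simp add: nth_append)
    then show ?thesis unfolding \<open>_ = s ! _\<close> using *[OF t(1), of v] t(2) by auto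
  qed auto
  have upper: "v \<le> (0 # s @ [n]) ! i \<longleftrightarrow> v \<le> n \<and> 1 + card {a \<in> A. a < v} \<le> i"
  proof (cases "i = card A + 1")
    case True
    then show ?thesis using le[of v] s(3) by (simp add: nth_append)
  next
    case False
    then have t: "i - 1 < length s" "i = Suc (i - 1)" using i s(3) by auto
    then have "(0 # s @ [n]) ! i = s ! (i - 1)"
      by (metis nth_Cons_Suc nth_append)
    moreover have "s ! (i - 1) < n"
      using A s(2) nth_mem[OF t(1)] by auto
    ultimately show ?thesis using *[OF t(1), of v] t(2) by linarith
  qed
  show ?thesis
    using lower upper unfolding block_def Let_def s_def[symmetric] atLeastAtMost_iff by auto
qed

text \<open>Applied once to the row as a function of the position, with
  \<open>A = comp_set \<alpha>\<close>, and once to the column as a function of the entry, with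
  \<open>A\<close> the set of descents.\<close>

lemma step_function_eq_card:
  fixes X :: "nat \<Rightarrow> nat"
  assumes X: "X 1 = 1" and step: "\<And>v. v \<in> {1..<n} \<Longrightarrow> X (v + 1) = X v + (if v \<in> A then 1 else 0)"
    and A: "A \<subseteq> {1..<n}" and v: "v \<in> {1..n}"
  shows "X v = 1 + card {a \<in> A. a < v}"
  using v
proof (induction v)
  case (Suc v)
  show ?case
  proof (cases "v = 0")
    case True
    then have "{a \<in> A. a < Suc v} = {}" using A by auto
    then show ?thesis using X True by (simp only: One_nat_def card.empty add_0_right)
  next
    case False
    then have v: "v \<in> {1..<n}" using Suc.prems by auto
    have fin: "finite {a \<in> A. a < v}" by simp
    have "{a \<in> A. a < Suc v} = (if v \<in> A then insert v {a \<in> A. a < v} else {a \<in> A. a < v})"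
      by (auto simp: less_Suc_eq)
    then have "card {a \<in> A. a < Suc v} = card {a \<in> A. a < v} + (if v \<in> A then 1 else 0)"
      using fin by simp
    then show ?thesis using Suc.IH step[OF v] v by simp
  qed
qed simp

section \<open>Ranks in a lexicographic order\<close>

text \<open>The counted sets are initial segments of a total preorder, hence nested, so their sizes
  reflect the order. Injectivity of the pair of keys then excludes ties. All three fillings are
  ranks of this kind.\<close>

lemma lex_rank:
  fixes f g :: "'b \<Rightarrow> nat"
  assumes fin: "finite B" and inj: "inj_on (\<lambda>b. (f b, g b)) B"
    and r: "\<And>b. b \<in> B \<Longrightarrow> r b = card {c \<in> B. f c < f b \<or> f c = f b \<and> g c \<le> g b}"
  shows lex_rank_le_iff:
      "\<And>b c. b \<in> B \<Longrightarrow> c \<in> B \<Longrightarrow> r b \<le> r c \<longleftrightarrow> f b < f c \<or> f b = f c \<and> g b \<le> g c"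
    and bij_betw_lex_rank: "bij_betw r B {1..card B}"
proof -
  let ?S = "\<lambda>b. {c \<in> B. f c < f b \<or> f c = f b \<and> g c \<le> g b}"
  show le_iff: "r b \<le> r c \<longleftrightarrow> f b < f c \<or> f b = f c \<and> g b \<le> g c" if bc: "b \<in> B" "c \<in> B" for b c
  proof (cases "f b < f c \<or> f b = f c \<and> g b \<le> g c")
    case True
    then have "?S b \<subseteq> ?S c" by auto
    then have "card (?S b) \<le> card (?S c)" using fin by (intro card_mono) auto
    then show ?thesis using True bc r by simp
  next
    case False
    then have "?S c \<subset> ?S b" using bc by (auto simp: psubset_eq)
    then have "card (?S c) < card (?S b)" using fin by (intro psubset_card_mono) auto
    then show ?thesis using False bc r by simp
  qed
  have inj_r: "inj_on r B"
  proof (rule inj_onI)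
    fix b c assume bc: "b \<in> B" "c \<in> B" "r b = r c"
    then have "(f b, g b) = (f c, g c)" using le_iff[of b c] le_iff[of c b] by auto
    then show "b = c" using inj_onD[OF inj] bc by blast
  qed
  have "r b \<in> {1..card B}" if "b \<in> B" for b
  proof -
    have "b \<in> ?S b" using that by simp
    then have "card (?S b) \<noteq> 0" using fin by auto
    moreover have "card (?S b) \<le> card B" using fin by (intro card_mono) auto
    ultimately show ?thesis using r[OF that] by simp
  qed
  then have "r ` B = {1..card B}"
    by (intro card_subset_eq) (auto simp: card_image[OF inj_r])
  then show "bij_betw r B {1..card B}" using inj_r by (simp add: bij_betw_def)
qed

section \<open>Boxes in reading order\<close>

text \<open>The reading order detached from any filling: every reading word is an image of this one
  list, so a position can be identified with a box.\<close>

definition box_list :: "nat list \<Rightarrow> (nat \<times> nat) list" where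
  "box_list \<alpha> = concat (map (\<lambda>i. map (Pair i) (rev [1..<\<alpha> ! (i - 1) + 1])) [1..<length \<alpha> + 1])"

lemma box_list_Nil [simp]: "box_list [] = []"
  by (simp add: box_list_def)

lemma box_list_snoc:
  "box_list (\<alpha> @ [a]) = box_list \<alpha> @ map (Pair (length \<alpha> + 1)) (rev [1..<a + 1])"
proof -
  let ?f = "\<lambda>\<alpha> i. map (Pair i) (rev [1..<\<alpha> ! (i - 1) + 1])"
  have "map (?f (\<alpha> @ [a])) [1..<length \<alpha> + 1] = map (?f \<alpha>) [1..<length \<alpha> + 1]"
    by (rule map_cong[OF refl]) (auto simp: nth_append)
  moreover have "[1..<length (\<alpha> @ [a]) + 1] = [1..<length \<alpha> + 1] @ [length \<alpha> + 1]"
    by simp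
  ultimately show ?thesis unfolding box_list_def by (simp only: map_append concat_append) simp
qed

lemma set_box_list: "set (box_list \<alpha>) = cd \<alpha>"
  by (fastforce simp: box_list_def cd_def)

lemma finite_cd [simp]: "finite (cd \<alpha>)"
  unfolding set_box_list[symmetric] by (rule finite_set)

lemma length_box_list: "length (box_list \<alpha>) = sum_list \<alpha>"
  by (induction \<alpha> rule: rev_induct) (simp_all add: box_list_snoc)

lemma sorted_box_list:
  "sorted_wrt (\<lambda>b c. fst b < fst c \<or> fst b = fst c \<and> snd c < snd b) (box_list \<alpha>)"
proof (induction \<alpha> rule: rev_induct)
  case (snoc a \<alpha>)
  have "fst b < length \<alpha> + 1" if "b \<in> set (box_list \<alpha>)" for b
    using that by (auto simp: set_box_list cd_def)
  then show ?case using snoc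
    by (simp add: box_list_snoc sorted_wrt_append sorted_wrt_map sorted_wrt_rev del: upt_Suc)
qed simp

lemma reading_word_eq: "reading_word \<alpha> T = map T (box_list \<alpha>)"
  by (simp add: reading_word_def box_list_def map_concat comp_def del: upt_Suc)

definition box :: "nat list \<Rightarrow> nat \<Rightarrow> nat \<times> nat" where
  "box \<alpha> p = box_list \<alpha> ! (p - 1)"

lemma box_less_iff:
  assumes "p \<in> {1..sum_list \<alpha>}" and "q \<in> {1..sum_list \<alpha>}"
  shows "p < q \<longleftrightarrow> fst (box \<alpha> p) < fst (box \<alpha> q) \<or>
           fst (box \<alpha> p) = fst (box \<alpha> q) \<and> snd (box \<alpha> q) < snd (box \<alpha> p)"
proof -
  let ?less = "\<lambda>b c. fst b < fst c \<or> fst b = fst c \<and> snd c < snd b"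
  have *: "?less (box \<alpha> p) (box \<alpha> q)" if "p < q" "1 \<le> p" "q \<le> sum_list \<alpha>" for p q
    using that sorted_wrt_nth_less[OF sorted_box_list, of "p - 1" "q - 1" \<alpha>]
    by (simp add: box_def length_box_list)
  show ?thesis
    using *[of p q] *[of q p] assms by (cases p q rule: linorder_cases) auto
qed

lemma box_in_cd: "p \<in> {1..sum_list \<alpha>} \<Longrightarrow> box \<alpha> p \<in> cd \<alpha>"
  unfolding box_def set_box_list[symmetric] by (rule nth_mem) (auto simp: length_box_list)

lemma bij_betw_box: "bij_betw (box \<alpha>) {1..sum_list \<alpha>} (cd \<alpha>)"
  unfolding bij_betw_def
proof
  show "inj_on (box \<alpha>) {1..sum_list \<alpha>}"
    using box_less_iff by (intro linorder_inj_onI) (fastforce, auto)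
  show "box \<alpha> ` {1..sum_list \<alpha>} = cd \<alpha>"
  proof
    show "cd \<alpha> \<subseteq> box \<alpha> ` {1..sum_list \<alpha>}"
    proof
      fix b assume "b \<in> cd \<alpha>"
      then obtain j where "j < sum_list \<alpha>" "b = box_list \<alpha> ! j"
        unfolding set_box_list[symmetric] by (auto simp: in_set_conv_nth length_box_list)
      then show "b \<in> box \<alpha> ` {1..sum_list \<alpha>}"
        by (intro image_eqI[of _ _ "j + 1"]) (auto simp: box_def)
    qed
  qed (use box_in_cd in auto)
qed

lemma card_cd: "card (cd \<alpha>) = sum_list \<alpha>"
  using bij_betw_same_card[OF bij_betw_box[of \<alpha>]] by simp

lemma fst_box_sum_list: "composition_of n \<alpha> \<Longrightarrow> \<alpha> \<noteq> [] \<Longrightarrow> fst (box \<alpha> (sum_list \<alpha>)) = length \<alpha>"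
  by (cases \<alpha> rule: rev_cases)
    (auto simp: box_def box_list_snoc nth_append length_box_list composition_of_snoc simp del: upt_Suc)

lemma fst_box_1:
  assumes "composition_of n \<alpha>" "\<alpha> \<noteq> []"
  shows "fst (box \<alpha> 1) = 1"
proof -
  have "(1, 1) \<in> cd \<alpha>" using assms by (cases \<alpha>) (auto simp: cd_def composition_of_def)
  then obtain p where p: "p \<in> {1..sum_list \<alpha>}" "box \<alpha> p = (1, 1)"
    using bij_betw_box[of \<alpha>] by (metis bij_betw_imp_surj_on imageE)
  have "1 \<in> {1..sum_list \<alpha>}" using p by auto
  moreover have "fst (box \<alpha> 1) \<ge> 1" using box_in_cd[OF calculation] by (auto simp: cd_def)
  ultimately show ?thesis using box_less_iff[of 1 \<alpha> p] p by (cases "p = 1") auto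
qed

text \<open>The partial sums of \<alpha> are the positions at which a row of the diagram has been
  read completely.\<close>

lemma fst_box_Suc:
  assumes "composition_of n \<alpha>" and "p \<in> {1..<n}"
  shows "fst (box \<alpha> (p + 1)) = fst (box \<alpha> p) + (if p \<in> comp_set \<alpha> then 1 else 0)"
  using assms
proof (induction \<alpha> arbitrary: n p rule: rev_induct)
  case (snoc a \<alpha>)
  then have comp: "composition_of (sum_list \<alpha>) \<alpha>" and n: "n = sum_list \<alpha> + a"
    by (auto simp: composition_of_snoc)
  have old: "box (\<alpha> @ [a]) q = box \<alpha> q" if "q \<in> {1..sum_list \<alpha>}" for q
    using that by (auto simp: box_def box_list_snoc nth_append length_box_list)
  have new: "fst (box (\<alpha> @ [a]) q) = length \<alpha> + 1" if "q \<in> {sum_list \<alpha> + 1..n}" for q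
    using that n
    by (auto simp: box_def box_list_snoc nth_append length_box_list simp del: upt_Suc)
  have sub: "comp_set \<alpha> \<subseteq> {1..<sum_list \<alpha>}" using comp by (rule comp_set_subset)
  consider "p < sum_list \<alpha>" | "p = sum_list \<alpha>" | "p > sum_list \<alpha>" by linarith
  then show ?case
  proof cases
    case 1
    then show ?thesis
      using snoc.IH[OF comp, of p] snoc.prems old[of p] old[of "p + 1"] by (auto simp: comp_set_snoc)
  next
    case 2
    then have "\<alpha> \<noteq> []" using snoc.prems by auto
    then show ?thesis
      using fst_box_sum_list[OF comp] 2 snoc.prems old[of p] new[of "p + 1"] n
      by (auto simp: comp_set_snoc)
  next
    case 3
    then show ?thesis
      using snoc.prems new[of p] new[of "p + 1"] sub by (auto simp: comp_set_snoc)
  qed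
qed simp

section \<open>Permutations read off from fillings\<close>

lemma read_perm_eq: "p \<in> {1..sum_list \<alpha>} \<Longrightarrow> read_perm \<alpha> T p = T (box \<alpha> p)"
  by (auto simp: perm_of_word_def reading_word_eq length_box_list box_def)

lemma read_perm_permutes:
  assumes "bij_betw T (cd \<alpha>) {1..sum_list \<alpha>}"
  shows "read_perm \<alpha> T permutes {1..sum_list \<alpha>}"
proof (rule bij_imp_permutes)
  have "bij_betw (T \<circ> box \<alpha>) {1..sum_list \<alpha>} {1..sum_list \<alpha>}"
    using bij_betw_box assms by (rule bij_betw_trans)
  then show "bij_betw (read_perm \<alpha> T) {1..sum_list \<alpha>} {1..sum_list \<alpha>}"
    by (rule bij_betw_cong[THEN iffD1, rotated]) (simp only: read_perm_eq o_apply)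
qed (auto simp: perm_of_word_def reading_word_eq length_box_list)

lemma filling_T_rank:
  "filling_T \<alpha> b = card {c \<in> cd \<alpha>. fst c < fst b \<or> fst c = fst b \<and> snd c \<le> snd b}"
  by (cases b) (auto simp: filling_T_def intro!: arg_cong[of _ _ card])

lemma filling_T_le_iff:
  "b \<in> cd \<alpha> \<Longrightarrow> c \<in> cd \<alpha> \<Longrightarrow>
    filling_T \<alpha> b \<le> filling_T \<alpha> c \<longleftrightarrow> fst b < fst c \<or> fst b = fst c \<and> snd b \<le> snd c"
  by (rule lex_rank_le_iff[OF finite_cd _ filling_T_rank]) (auto simp: inj_on_def)

lemma read_perm_filling_T_permutes:
  "read_perm \<alpha> (filling_T \<alpha>) permutes {1..sum_list \<alpha>}"
proof (rule read_perm_permutes)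
  show "bij_betw (filling_T \<alpha>) (cd \<alpha>) {1..sum_list \<alpha>}"
    unfolding card_cd[symmetric]
    by (rule bij_betw_lex_rank[OF finite_cd _ filling_T_rank]) (auto simp: inj_on_def)
qed

text \<open>The filling increases along each row and from each row to the next, and reading reverses
  only the order inside the rows.\<close>

lemma inversions_read_perm_filling_T:
  "inversions (sum_list \<alpha>) (read_perm \<alpha> (filling_T \<alpha>)) =
     {(p, q). p \<in> {1..sum_list \<alpha>} \<and> q \<in> {1..sum_list \<alpha>} \<and> p < q \<and> fst (box \<alpha> p) = fst (box \<alpha> q)}"
proof -
  have *: "filling_T \<alpha> (box \<alpha> q) < filling_T \<alpha> (box \<alpha> p) \<longleftrightarrow> fst (box \<alpha> p) = fst (box \<alpha> q)"
    if "p \<in> {1..sum_list \<alpha>}" "q \<in> {1..sum_list \<alpha>}" "p < q" for p q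
    using box_less_iff[OF that(1,2)] that(3) filling_T_le_iff[OF box_in_cd[OF that(1)] box_in_cd[OF that(2)]]
    by (auto simp: not_le[symmetric])
  have "(p, q) \<in> inversions (sum_list \<alpha>) (read_perm \<alpha> (filling_T \<alpha>)) \<longleftrightarrow>
      p \<in> {1..sum_list \<alpha>} \<and> q \<in> {1..sum_list \<alpha>} \<and> p < q \<and> fst (box \<alpha> p) = fst (box \<alpha> q)" for p q
  proof (cases "p \<in> {1..sum_list \<alpha>} \<and> q \<in> {1..sum_list \<alpha>} \<and> p < q")
    case True
    then show ?thesis
      using *[of p q] read_perm_eq[of p \<alpha>] read_perm_eq[of q \<alpha>] by (simp add: inversions_def)
  qed (auto simp: inversions_def)
  then show ?thesis by auto
qed

lemma fst_box_mono:
  "p \<in> {1..sum_list \<alpha>} \<Longrightarrow> q \<in> {1..sum_list \<alpha>} \<Longrightarrow> p \<le> q \<Longrightarrow> fst (box \<alpha> p) \<le> fst (box \<alpha> q)"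
  using box_less_iff[of p \<alpha> q] by (cases "p = q") auto

text \<open>For \<open>i\<close> outside \<open>comp_set \<alpha>\<close> the positions
  \<open>i\<close> and \<open>i + 1\<close> share a row, so the parabolic subgroup preserves rows
  and can invert only pairs within a row. The reading word inverts all of these; that it lies in the
  subgroup is shown along a chain of ascents from \<open>id\<close>.\<close>

lemma w0_comp_comp_compl:
  assumes comp: "composition_of n \<alpha>"
  shows "w0_comp (comp_compl \<alpha>) = read_perm \<alpha> (filling_T \<alpha>)"
proof -
  let ?S = "simple_refl ` comp_set (comp_compl \<alpha>)"
  let ?W = "generate (sym_group n) ?S"
  let ?\<rho> = "read_perm \<alpha> (filling_T \<alpha>)"
  have sum: "sum_list \<alpha> = n" "sum_list (comp_compl \<alpha>) = n"
    using comp comp_compl(1)[OF comp] by (auto simp: composition_of_def)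
  have S: "s permutes {1..n}" "inv' s = s" "\<And>p. p \<in> {1..n} \<Longrightarrow> fst (box \<alpha> (s p)) = fst (box \<alpha> p)"
    if s: "s \<in> ?S" for s
  proof -
    obtain i where i: "s = simple_refl i" "i \<in> {1..<n}" "i \<notin> comp_set \<alpha>"
      using s unfolding comp_compl(2)[OF comp] by blast
    show "s permutes {1..n}" using i simple_refl_permutes by blast
    show "inv' s = s" by (simp add: i simple_refl_def)
    show "\<And>p. p \<in> {1..n} \<Longrightarrow> fst (box \<alpha> (s p)) = fst (box \<alpha> p)"
      using fst_box_Suc[OF comp i(2)] i by (auto simp: simple_refl_def transpose_def)
  qed
  have group: "group (sym_group n)" by (rule sym_group_is_group)
  have S_carrier: "?S \<subseteq> carrier (sym_group n)" using S(1) by (auto simp: sym_group_carrier)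
  have inv_S: "inv\<^bsub>sym_group n\<^esub> s = s" if "s \<in> ?S" for s
  proof (rule group.inv_equality[OF group])
    show "s \<in> carrier (sym_group n)" using that S_carrier by blast
    then show "s \<in> carrier (sym_group n)" .
    show "s \<otimes>\<^bsub>sym_group n\<^esub> s = \<one>\<^bsub>sym_group n\<^esub>"
      using permutes_inv_o(2)[OF S(1)[OF that]] S(2)[OF that]
      by (simp add: sym_group_mult sym_group_one)
  qed
  have W: "v permutes {1..n} \<and> (\<forall>p\<in>{1..n}. fst (box \<alpha> (v p)) = fst (box \<alpha> p))" if "v \<in> ?W" for v
    using that
  proof (induction rule: generate.induct)
    case one
    show ?case unfolding sym_group_one by (intro conjI permutes_id ballI) (simp only: id_apply)
  next
    case (incl s)
    then show ?case using S by blast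
  next
    case (inv s)
    then show ?case unfolding inv_S[OF inv] using S by blast
  next
    case (eng u v)
    then have u: "u permutes {1..n}" and v: "v permutes {1..n}" by blast+
    have "fst (box \<alpha> ((u \<circ> v) p)) = fst (box \<alpha> p)" if "p \<in> {1..n}" for p
    proof -
      have "v p \<in> {1..n}" using permutes_in_image[OF v] that by blast
      then have "fst (box \<alpha> (u (v p))) = fst (box \<alpha> (v p))" using eng.IH(1) by blast
      also have "\<dots> = fst (box \<alpha> p)" using eng.IH(2) that by blast
      finally show ?thesis by (simp only: o_apply)
    qed
    then show ?case unfolding sym_group_mult using permutes_compose[OF v u] by blast
  qed
  have in_W: "inversions n \<gamma> \<subseteq> inversions n ?\<rho> \<longrightarrow> \<gamma> \<in> ?W" if "(ascent_step n)\<^sup>*\<^sup>* id \<gamma>" for \<gamma>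
    using that
  proof (induction rule: rtranclp_induct)
    case base
    show ?case using generate.one[of "sym_group n" ?S] unfolding sym_group_one by blast
  next
    case (step \<gamma> \<delta>)
    show ?case
    proof
      assume le: "inversions n \<delta> \<subseteq> inversions n ?\<rho>"
      from step.hyps(2) obtain i where \<gamma>: "\<gamma> permutes {1..n}" and i: "i \<in> {1..<n}"
        and \<delta>: "\<delta> = simple_refl i \<circ> \<gamma>" and asc: "inv' \<gamma> i < inv' \<gamma> (i + 1)"
        unfolding ascent_step_def by blast
      have inversions_\<delta>: "inversions n \<delta> = insert (inv' \<gamma> i, inv' \<gamma> (i + 1)) (inversions n \<gamma>)"
        unfolding \<delta> by (rule inversions_ascent(1)[OF \<gamma> i asc])
      then have \<gamma>_W: "\<gamma> \<in> ?W" using step.IH le by blast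
      have "(inv' \<gamma> i, inv' \<gamma> (i + 1)) \<in> inversions n ?\<rho>" using inversions_\<delta> le by blast
      then have r: "inv' \<gamma> i \<in> {1..n}" "inv' \<gamma> (i + 1) \<in> {1..n}"
        and same_row: "fst (box \<alpha> (inv' \<gamma> i)) = fst (box \<alpha> (inv' \<gamma> (i + 1)))"
        unfolding sum(1)[symmetric] inversions_read_perm_filling_T by blast+
      \<comment> \<open>The new inversion gives two positions in one row. Since \<gamma> preserves
        rows, the values \<open>i\<close> and \<open>i + 1\<close> at these positions also belong to
        one row, which makes \<open>simple_refl i\<close> a generator.\<close>
      have "fst (box \<alpha> (\<gamma> (inv' \<gamma> i))) = fst (box \<alpha> (inv' \<gamma> i))"
        using W[OF \<gamma>_W] r(1) by blast
      also note same_row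
      also have "fst (box \<alpha> (inv' \<gamma> (i + 1))) = fst (box \<alpha> (\<gamma> (inv' \<gamma> (i + 1))))"
        by (rule sym) (use W[OF \<gamma>_W] r(2) in blast)
      finally have "fst (box \<alpha> (\<gamma> (inv' \<gamma> i))) = fst (box \<alpha> (\<gamma> (inv' \<gamma> (i + 1))))" .
      then have "fst (box \<alpha> i) = fst (box \<alpha> (i + 1))"
        by (simp only: permutes_inverses(1)[OF \<gamma>])
      then have "i \<notin> comp_set \<alpha>" using fst_box_Suc[OF comp i] by auto
      then have "simple_refl i \<in> ?S" using i unfolding comp_compl(2)[OF comp] by blast
      then have "simple_refl i \<in> ?W" by (rule generate.incl)
      then show "\<delta> \<in> ?W"
        using generate.eng[OF _ \<gamma>_W] unfolding \<delta> sym_group_mult by blast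
    qed
  qed
  have \<rho>: "?\<rho> permutes {1..n}" using read_perm_filling_T_permutes sum by metis
  show ?thesis
    unfolding w0_comp_def sum
  proof (rule longest_elem_eq)
    show "v permutes {1..n}" if "v \<in> ?W" for v using W[OF that] by blast
    have "inversions n id \<subseteq> inversions n ?\<rho>" by (simp only: inversions_id empty_subsetI)
    then show "?\<rho> \<in> ?W"
      using in_W ascent_steps_if_inversions_subset[OF permutes_id \<rho>] by blast
    show "inversions n v \<subseteq> inversions n ?\<rho>" if "v \<in> ?W" for v
    proof (rule subrelI)
      fix p q assume "(p, q) \<in> inversions n v"
      then have pq: "p \<in> {1..n}" "q \<in> {1..n}" "p < q" "v q < v p" by (auto simp: inversions_def)
      have v: "v p \<in> {1..n}" "v q \<in> {1..n}"
        using permutes_in_image[of v "{1..n}"] W[OF that] pq by blast+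
      have "fst (box \<alpha> (v p)) = fst (box \<alpha> p)" "fst (box \<alpha> (v q)) = fst (box \<alpha> q)"
        using W[OF that] pq by blast+
      \<comment> \<open>Rows weakly increase with the position. As \<open>v\<close> preserves rows
        but reverses \<open>p\<close> and \<open>q\<close>, both inequalities hold between the same
        two rows, in opposite directions.\<close>
      moreover have "fst (box \<alpha> p) \<le> fst (box \<alpha> q)" "fst (box \<alpha> (v q)) \<le> fst (box \<alpha> (v p))"
        using fst_box_mono[of _ \<alpha>] pq v sum by auto
      ultimately have "fst (box \<alpha> p) = fst (box \<alpha> q)" by linarith
      then show "(p, q) \<in> inversions n ?\<rho>"
        using pq unfolding sum(1)[symmetric] inversions_read_perm_filling_T by blast
    qed
  qed
qed

section \<open>Fillings along columns\<close>

text \<open>The common shape of both upper fillings, with \<open>x\<close> the future column of a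
  box in the configuration. By \<open>x_init\<close> no column number is skipped, so columns can be
  numbered by counting descents.\<close>

locale column_filling =
  fixes n :: nat and \<alpha> :: "nat list" and T x :: "nat \<times> nat \<Rightarrow> nat"
  assumes comp: "composition_of n \<alpha>"
    and row_mono: "(i, j) \<in> cd \<alpha> \<Longrightarrow> (i, j') \<in> cd \<alpha> \<Longrightarrow> j < j' \<Longrightarrow> x (i, j) < x (i, j')"
    and x_pos: "b \<in> cd \<alpha> \<Longrightarrow> 1 \<le> x b"
    and x_init: "b \<in> cd \<alpha> \<Longrightarrow> 1 \<le> c \<Longrightarrow> c \<le> x b \<Longrightarrow> \<exists>b'\<in>cd \<alpha>. x b' = c"
    \<comment> \<open>forces the last entry of a column not to lie above the first entry of the next one,
      so that it is a descent of the reading word\<close>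
    and between: "b \<in> cd \<alpha> \<Longrightarrow> b' \<in> cd \<alpha> \<Longrightarrow> x b' = x b + 1 \<Longrightarrow> fst b < fst b' \<Longrightarrow>
      \<exists>c\<in>cd \<alpha>. x c = x b \<and> fst b < fst c \<or> x c = x b' \<and> fst c < fst b'"
    and T_rank: "b \<in> cd \<alpha> \<Longrightarrow> T b = card {c \<in> cd \<alpha>. x c < x b \<or> x c = x b \<and> fst c \<le> fst b}"
begin

abbreviation "\<rho> \<equiv> read_perm \<alpha> T"

abbreviation "D \<equiv> (\<lambda>b. (x b, fst b)) ` cd \<alpha>"

lemma sum_list_eq: "sum_list \<alpha> = n"
  using comp by (simp add: composition_of_def)

lemma row_less_iff:
  assumes "b \<in> cd \<alpha>" "c \<in> cd \<alpha>" "fst b = fst c"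
  shows "x b < x c \<longleftrightarrow> snd b < snd c"
proof -
  obtain i j j' where "b = (i, j)" "c = (i, j')" using assms(3) by (cases b; cases c) auto
  then show ?thesis
    using row_mono[of i j j'] row_mono[of i j' j] assms by (cases j j' rule: linorder_cases) auto
qed

lemma inj_on_coords: "inj_on (\<lambda>b. (x b, fst b)) (cd \<alpha>)"
proof (rule inj_onI)
  fix b c assume bc: "b \<in> cd \<alpha>" "c \<in> cd \<alpha>" "(x b, fst b) = (x c, fst c)"
  then have "snd b = snd c" using row_less_iff[of b c] row_less_iff[of c b] by auto
  then show "b = c" using bc by (auto simp: prod_eq_iff)
qed

lemma T_le_iff:
  "b \<in> cd \<alpha> \<Longrightarrow> c \<in> cd \<alpha> \<Longrightarrow> T b \<le> T c \<longleftrightarrow> x b < x c \<or> x b = x c \<and> fst b \<le> fst c"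
  by (rule lex_rank_le_iff[OF finite_cd inj_on_coords T_rank])

lemma bij_betw_T: "bij_betw T (cd \<alpha>) {1..n}"
  using bij_betw_lex_rank[OF finite_cd inj_on_coords T_rank] by (simp add: card_cd sum_list_eq)

lemma \<rho>_permutes: "\<rho> permutes {1..n}"
  using read_perm_permutes[of T \<alpha>] bij_betw_T unfolding sum_list_eq by blast

lemma \<rho>_eq: "p \<in> {1..n} \<Longrightarrow> \<rho> p = T (box \<alpha> p)"
  using read_perm_eq[of p \<alpha>] unfolding sum_list_eq by blast

lemma box_cd: "p \<in> {1..n} \<Longrightarrow> box \<alpha> p \<in> cd \<alpha>"
  using box_in_cd[of p \<alpha>] unfolding sum_list_eq by blast

text \<open>In a single row both orders compare \<open>x\<close>. In different rows the lower
  filling compares rows, and then the tie rule of \<open>T\<close> turns \<open>x b < x c\<close>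
  into \<open>x b \<le> x c\<close>.\<close>

lemma both_le_iff:
  assumes "b \<in> cd \<alpha>" "c \<in> cd \<alpha>"
  shows "filling_T \<alpha> b \<le> filling_T \<alpha> c \<and> T b \<le> T c \<longleftrightarrow> x b \<le> x c \<and> fst b \<le> fst c"
  using filling_T_le_iff[OF assms] T_le_iff[OF assms] row_less_iff[OF assms(2,1)] by auto

text \<open>Serves twice: as the comparability required for the poset of the interval, and as the
  guard in the definition of \<open>D_boxes\<close>.\<close>

lemma inversions_filling_T_subset: "inversions n (read_perm \<alpha> (filling_T \<alpha>)) \<subseteq> inversions n \<rho>"
proof (rule subrelI)
  fix p q assume "(p, q) \<in> inversions n (read_perm \<alpha> (filling_T \<alpha>))"
  then have pq: "p \<in> {1..n}" "q \<in> {1..n}" "p < q" "fst (box \<alpha> p) = fst (box \<alpha> q)"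
    using inversions_read_perm_filling_T[of \<alpha>] unfolding sum_list_eq by blast+
  then have "snd (box \<alpha> q) < snd (box \<alpha> p)"
    using box_less_iff[of p \<alpha> q] by (simp add: sum_list_eq)
  then have "x (box \<alpha> q) < x (box \<alpha> p)"
    using row_less_iff pq box_cd by metis
  then have "T (box \<alpha> q) < T (box \<alpha> p)"
    using T_le_iff[of "box \<alpha> p" "box \<alpha> q"] box_cd pq by (simp add: not_le[symmetric])
  then show "(p, q) \<in> inversions n \<rho>"
    using pq \<rho>_eq[OF pq(1)] \<rho>_eq[OF pq(2)] by (simp add: inversions_def)
qed

section \<open>Columns along increasing entries and the descents of the upper reading word\<close>

definition box_of :: "nat \<Rightarrow> nat \<times> nat" where
  "box_of v = box \<alpha> (inv' \<rho> v)"

lemma inv_\<rho>_in: "v \<in> {1..n} \<Longrightarrow> inv' \<rho> v \<in> {1..n}"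
  using permutes_in_image[OF permutes_inv[OF \<rho>_permutes]] by blast

lemma box_of_in: "v \<in> {1..n} \<Longrightarrow> box_of v \<in> cd \<alpha>"
  unfolding box_of_def by (intro box_cd inv_\<rho>_in)

lemma T_box_of: "v \<in> {1..n} \<Longrightarrow> T (box_of v) = v"
  unfolding box_of_def using \<rho>_eq[OF inv_\<rho>_in] permutes_inverses(1)[OF \<rho>_permutes] by metis

lemma T_in: "b \<in> cd \<alpha> \<Longrightarrow> T b \<in> {1..n}"
  using bij_betw_T by (rule bij_betwE[THEN bspec])

lemma x_box_of_1:
  assumes "1 \<le> n"
  shows "x (box_of 1) = 1"
proof (rule ccontr)
  assume ne: "x (box_of 1) \<noteq> 1"
  have 1: "1 \<in> {1..n}" using assms by simp
  then have gt: "1 < x (box_of 1)" using x_pos[OF box_of_in[OF 1]] ne by linarith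
  then obtain c where c: "c \<in> cd \<alpha>" "x c = 1" using x_init[OF box_of_in[OF 1], of 1] by auto
  then have "T c < T (box_of 1)"
    using T_le_iff[OF box_of_in[OF 1] c(1)] gt by (simp add: not_le[symmetric])
  then show False using T_box_of[OF 1] T_in[OF c(1)] by simp
qed

text \<open>Inside a column the next entry lies in a later row and is read later, so there is no
  descent. On a change of column, \<open>x_init\<close> makes the new column the next one and
  \<open>between\<close> keeps the new box from lying in a later row; in an earlier row, or further
  right in the same row, it is read first.\<close>

lemma x_box_of_Suc:
  assumes v: "v \<in> {1..<n}"
  shows "x (box_of (v + 1)) = x (box_of v) + (if v \<in> DesL n \<rho> then 1 else 0)"
proof -
  let ?b = "box_of v" and ?b' = "box_of (v + 1)"
  have vn: "v \<in> {1..n}" "v + 1 \<in> {1..n}" using v by auto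
  note b = box_of_in[OF vn(1)] and b' = box_of_in[OF vn(2)]
  \<comment> \<open>No box holds an entry strictly between \<open>v\<close> and
    \<open>v + 1\<close>; every box squeezed in between the two in the order of \<open>T\<close> is
    therefore a contradiction.\<close>
  have none: False if "c \<in> cd \<alpha>" "\<not> T c \<le> T ?b" "\<not> T ?b' \<le> T c" for c
    using that T_box_of[OF vn(1)] T_box_of[OF vn(2)] by simp
  have le: "x ?b < x ?b' \<or> x ?b = x ?b' \<and> fst ?b \<le> fst ?b'"
    using T_le_iff[OF b b'] T_box_of[OF vn(1)] T_box_of[OF vn(2)] by simp
  have ne: "?b \<noteq> ?b'" using T_box_of[OF vn(1)] T_box_of[OF vn(2)] by auto
  have des: "v \<in> DesL n \<rho> \<longleftrightarrow> fst ?b' < fst ?b \<or> fst ?b' = fst ?b \<and> snd ?b < snd ?b'"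
    using box_less_iff[of "inv' \<rho> (v + 1)" \<alpha> "inv' \<rho> v"] inv_\<rho>_in[OF vn(1)] inv_\<rho>_in[OF vn(2)] v
    unfolding sum_list_eq DesL_eq[OF \<rho>_permutes] box_of_def by blast
  show ?thesis
  proof (cases "x ?b = x ?b'")
    case True
    then have "fst ?b \<noteq> fst ?b'" using inj_onD[OF inj_on_coords _ b b'] ne by auto
    then show ?thesis using True le des by auto
  next
    case False
    then have less: "x ?b < x ?b'" using le by simp
    have step: "x ?b' = x ?b + 1"
    proof (rule ccontr)
      assume "x ?b' \<noteq> x ?b + 1"
      then obtain c where c: "c \<in> cd \<alpha>" "x c = x ?b + 1" "x c < x ?b'"
        using x_init[OF b', of "x ?b + 1"] less by auto
      then have "\<not> T c \<le> T ?b \<and> \<not> T ?b' \<le> T c"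
        unfolding T_le_iff[OF c(1) b] T_le_iff[OF b' c(1)] by linarith
      then show False using none[OF c(1)] by blast
    qed
    have "\<not> fst ?b < fst ?b'"
    proof
      assume "fst ?b < fst ?b'"
      then obtain c where c: "c \<in> cd \<alpha>" "x c = x ?b \<and> fst ?b < fst c \<or> x c = x ?b' \<and> fst c < fst ?b'"
        using between[OF b b' step] by blast
      then have "\<not> T c \<le> T ?b \<and> \<not> T ?b' \<le> T c"
        unfolding T_le_iff[OF c(1) b] T_le_iff[OF b' c(1)] using less by linarith
      then show False using none[OF c(1)] by blast
    qed
    then have "v \<in> DesL n \<rho>" using des row_less_iff[OF b b'] less by auto
    then show ?thesis using step by simp
  qed
qed

section \<open>Block indices as coordinates, and the configuration with its enumeration\<close>

lemma DesL_subset: "DesL n \<rho> \<subseteq> {1..<n}"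
  by (auto simp: DesL_def)

lemma x_box_of_card:
  assumes "v \<in> {1..n}"
  shows "x (box_of v) = 1 + card {a \<in> DesL n \<rho>. a < v}"
  by (rule step_function_eq_card[where X = "\<lambda>v. x (box_of v)", OF _ x_box_of_Suc DesL_subset assms])
    (use assms x_box_of_1 in auto)

lemma row_card:
  assumes "p \<in> {1..n}"
  shows "fst (box \<alpha> p) = 1 + card {a \<in> comp_set \<alpha>. a < p}"
proof (rule step_function_eq_card[where X = "\<lambda>p. fst (box \<alpha> p)",
      OF _ fst_box_Suc[OF comp] comp_set_subset[OF comp] assms])
  have "\<alpha> \<noteq> []" using assms comp by auto
  then show "fst (box \<alpha> 1) = 1" by (rule fst_box_1[OF comp])
qed

text \<open>A point of the configuration is witnessed by a position \<open>p\<close> in a block of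
  positions whose entry \<open>\<rho> p\<close> lies in a block of entries. The two block indices
  are the row and the column coordinate of the box at \<open>p\<close>, so each box contributes one
  point.\<close>

lemma D_boxes_eq: "D_boxes (comp_compl \<alpha>) \<rho> = D"
proof -
  let ?Z = "comp_set \<alpha>" and ?K = "DesL n \<rho>"
  have sum: "sum_list (comp_compl \<alpha>) = n"
    using comp_compl(1)[OF comp] by (simp add: composition_of_def)
  have weak: "weakL n (w0_comp (comp_compl \<alpha>)) \<rho>"
    unfolding w0_comp_comp_compl[OF comp]
    using weakL_iff_inversions_subset[OF _ \<rho>_permutes]
      read_perm_filling_T_permutes[of \<alpha>] inversions_filling_T_subset
    unfolding sum_list_eq by blast
  have D: "D_boxes (comp_compl \<alpha>) \<rho> = {(i, j). 1 \<le> i \<and> i \<le> card ?K + 1 \<and> 1 \<le> j \<and> j \<le> card ?Z + 1 \<and>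
                    \<rho> ` block n ?Z j \<inter> block n ?K i \<noteq> {}}"
    unfolding D_boxes_def Let_def sum comp_compl_comp_compl[OF comp]
    using weak \<rho>_permutes by (simp only: if_True simp_thms)
  note Z = block_iff[OF comp_set_subset[OF comp]] and K = block_iff[OF DesL_subset]
  have box_of_\<rho>: "box_of (\<rho> p) = box \<alpha> p" for p
    unfolding box_of_def by (simp only: permutes_inverses(2)[OF \<rho>_permutes])
  have \<rho>_in: "\<rho> p \<in> {1..n}" if "p \<in> {1..n}" for p
    using permutes_in_image[OF \<rho>_permutes] that by blast
  show ?thesis
  proof (rule Set.set_eqI, rule iffI)
    fix d assume "d \<in> D_boxes (comp_compl \<alpha>) \<rho>"
    then obtain i j p where d: "d = (i, j)" and i: "1 \<le> i" "i \<le> card ?K + 1" and j: "1 \<le> j" "j \<le> card ?Z + 1"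
      and p: "p \<in> block n ?Z j" "\<rho> p \<in> block n ?K i"
      unfolding D by blast
    have "p \<in> {1..n}" "j = fst (box \<alpha> p)" "i = x (box \<alpha> p)"
      using p Z[OF j] K[OF i] row_card x_box_of_card[of "\<rho> p"] by (auto simp: box_of_\<rho>)
    then show "d \<in> D" using d box_cd by blast
  next
    fix d assume "d \<in> D"
    then obtain b where b: "b \<in> cd \<alpha>" "d = (x b, fst b)" by blast
    then obtain p where p: "p \<in> {1..n}" "b = box \<alpha> p"
      using bij_betw_box[of \<alpha>] unfolding sum_list_eq by (metis bij_betw_imp_surj_on imageE)
    have x: "x b = 1 + card {a \<in> ?K. a < \<rho> p}"
      using x_box_of_card[OF \<rho>_in[OF p(1)]] by (simp only: box_of_\<rho> p(2))
    have row: "fst b = 1 + card {a \<in> ?Z. a < p}" using row_card[OF p(1)] p(2) by simp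
    have fin: "finite ?K" "finite ?Z"
      using DesL_subset comp_set_subset[OF comp] by (auto intro: finite_subset)
    have i: "1 \<le> x b" "x b \<le> card ?K + 1" and j: "1 \<le> fst b" "fst b \<le> card ?Z + 1"
      unfolding x row by (auto intro!: card_mono fin)
    have "p \<in> block n ?Z (fst b)" "\<rho> p \<in> block n ?K (x b)"
      using Z[OF j] K[OF i] p(1) \<rho>_in[OF p(1)] x row by blast+
    then show "d \<in> D_boxes (comp_compl \<alpha>) \<rho>" unfolding D b(2) using i j by blast
  qed
qed

text \<open>Row numbers count from the top in the diagram but from the bottom in the configuration,
  and \<open>x\<close> increases along rows; this accounts for the reversal of both directions of
  reading.\<close>

lemma boxes_enum_eq: "boxes_enum D = map (\<lambda>b. (x b, fst b)) (rev (box_list \<alpha>))"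
proof -
  have \<alpha>_pos: "1 \<le> \<alpha> ! (i - 1)" if "i \<in> {1..length \<alpha>}" for i
    using that comp by (auto simp: composition_of_def)
  have "snd ` D = {1..length \<alpha>}"
  proof
    show "{1..length \<alpha>} \<subseteq> snd ` D"
    proof
      fix i assume "i \<in> {1..length \<alpha>}"
      then have "(i, 1) \<in> cd \<alpha>" using \<alpha>_pos[of i] by (auto simp: cd_def)
      then show "i \<in> snd ` D" by force
    qed
  qed (auto simp: cd_def)
  then have rows: "sorted_list_of_set (snd ` D) = [1..<length \<alpha> + 1]"
    using sorted_list_of_set_range[of 1 "length \<alpha> + 1"]
    by (simp add: atLeastLessThanSuc_atLeastAtMost del: upt_Suc)
  have row: "map (\<lambda>c. (c, i)) (sorted_list_of_set {c. (c, i) \<in> D}) =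
      map (\<lambda>b. (x b, fst b)) (map (Pair i) [1..<\<alpha> ! (i - 1) + 1])" if i: "i \<in> {1..length \<alpha>}" for i
  proof -
    have "{c. (c, i) \<in> D} = set (map (\<lambda>j. x (i, j)) [1..<\<alpha> ! (i - 1) + 1])"
      using i by (force simp: cd_def image_iff)
    moreover have "sorted_wrt (<) (map (\<lambda>j. x (i, j)) [1..<\<alpha> ! (i - 1) + 1])"
      unfolding sorted_wrt_map
    proof (rule sorted_wrt_mono_rel[of _ "(<)"])
      show "sorted_wrt (<) [1..<\<alpha> ! (i - 1) + 1]" by (rule sorted_wrt_upt)
    qed (use i in \<open>auto intro!: row_mono simp: cd_def\<close>)
    ultimately have "sorted_list_of_set {c. (c, i) \<in> D} = map (\<lambda>j. x (i, j)) [1..<\<alpha> ! (i - 1) + 1]"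
      by (simp only: strict_sorted_iff sorted_list_of_set.idem_if_sorted_distinct)
    then show ?thesis by simp
  qed
  have "boxes_enum D =
      concat (map (\<lambda>i. map (\<lambda>c. (c, i)) (sorted_list_of_set {c. (c, i) \<in> D})) (rev [1..<length \<alpha> + 1]))"
    unfolding boxes_enum_def rows ..
  also have "\<dots> =
      concat (map (\<lambda>i. map (\<lambda>b. (x b, fst b)) (map (Pair i) [1..<\<alpha> ! (i - 1) + 1])) (rev [1..<length \<alpha> + 1]))"
    by (intro arg_cong[of _ _ concat] map_cong refl row) auto
  also have "\<dots> = map (\<lambda>b. (x b, fst b)) (rev (box_list \<alpha>))"
    by (simp add: box_list_def map_concat rev_concat rev_map comp_def del: upt_Suc)
  finally show ?thesis .
qed

lemma interval_poset_eq_P_D: "interval_poset n (read_perm \<alpha> (filling_T \<alpha>)) \<rho> = P_D D"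
proof -
  have card: "card D = n" using card_image[OF inj_on_coords] by (simp add: card_cd sum_list_eq)
  \<comment> \<open>The reversed enumeration produces the index \<open>n + 1 - i\<close> that
    \<open>w0 n\<close> produces in \<open>interval_poset_eq\<close>.\<close>
  have nth: "boxes_enum D ! (i - 1) = (x (box \<alpha> (n + 1 - i)), fst (box \<alpha> (n + 1 - i)))"
    if "i \<in> {1..n}" for i
  proof -
    have "i - 1 < length (box_list \<alpha>)" using that by (auto simp: length_box_list sum_list_eq)
    moreover have "length (box_list \<alpha>) - Suc (i - 1) = n + 1 - i - 1"
      using that by (auto simp: length_box_list sum_list_eq)
    ultimately have "rev (box_list \<alpha>) ! (i - 1) = box \<alpha> (n + 1 - i)"
      by (simp only: rev_nth box_def)
    then show ?thesis
      unfolding boxes_enum_eq using \<open>i - 1 < _\<close> by (simp only: nth_map length_rev)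
  qed
  have perm: "read_perm \<alpha> (filling_T \<alpha>) permutes {1..n}"
    using read_perm_filling_T_permutes[of \<alpha>] unfolding sum_list_eq .
  have T: "read_perm \<alpha> (filling_T \<alpha>) p = filling_T \<alpha> (box \<alpha> p)" if "p \<in> {1..n}" for p
    using read_perm_eq that unfolding sum_list_eq[symmetric] by blast
  have "read_perm \<alpha> (filling_T \<alpha>) (n + 1 - i) \<le> read_perm \<alpha> (filling_T \<alpha>) (n + 1 - j) \<and>
        \<rho> (n + 1 - i) \<le> \<rho> (n + 1 - j) \<longleftrightarrow>
        fst (boxes_enum D ! (i - 1)) \<le> fst (boxes_enum D ! (j - 1)) \<and>
        snd (boxes_enum D ! (i - 1)) \<le> snd (boxes_enum D ! (j - 1))"
    if ij: "i \<in> {1..n}" "j \<in> {1..n}" for i j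
  proof -
    have r: "n + 1 - i \<in> {1..n}" "n + 1 - j \<in> {1..n}" using ij by auto
    show ?thesis
      unfolding nth[OF ij(1)] nth[OF ij(2)] T[OF r(1)] T[OF r(2)] \<rho>_eq[OF r(1)] \<rho>_eq[OF r(2)] fst_conv snd_conv
      by (rule both_le_iff[OF box_cd[OF r(1)] box_cd[OF r(2)]])
  qed
  then show ?thesis
    unfolding interval_poset_eq[OF perm \<rho>_permutes inversions_filling_T_subset] P_D_def card by blast
qed

end

section \<open>Coordinates for the extended Schur and the dual immaculate fillings\<close>

lemma filling_X'_rank:
  "filling_X' \<alpha> b = card {c \<in> cd \<alpha>. snd c < snd b \<or> snd c = snd b \<and> fst c \<le> fst b}"
  by (cases b) (auto simp: filling_X'_def intro!: arg_cong[of _ _ card])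

text \<open>Left-justification supplies both witnesses: a row contains all columns before any of its
  boxes. In particular the box to the left of \<open>b'\<close> lies in the column of
  \<open>b\<close>, below \<open>b\<close>.\<close>

lemma column_filling_X':
  assumes "composition_of n \<alpha>"
  shows "column_filling n \<alpha> (filling_X' \<alpha>) snd"
proof
  show "\<exists>b'\<in>cd \<alpha>. snd b' = c" if "b \<in> cd \<alpha>" "1 \<le> c" "c \<le> snd b" for b c
    using that by (intro bexI[of _ "(fst b, c)"]) (auto simp: cd_def)
  show "\<exists>c\<in>cd \<alpha>. snd c = snd b \<and> fst b < fst c \<or> snd c = snd b' \<and> fst c < fst b'"
    if "b \<in> cd \<alpha>" "b' \<in> cd \<alpha>" "snd b' = snd b + 1" "fst b < fst b'" for b b'
    using that by (intro bexI[of _ "(fst b', snd b)"]) (auto simp: cd_def)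
qed (use assms filling_X'_rank in \<open>auto simp: cd_def\<close>)

text \<open>\<open>k i\<close> counts the boxes outside the first column in the rows below row
  \<open>i\<close>; as all parts are positive, the truncated subtraction is the true one.\<close>

locale column_offsets =
  fixes n :: nat and \<alpha> :: "nat list" and k :: "nat \<Rightarrow> nat"
  assumes comp: "composition_of n \<alpha>"
    and k: "\<And>i. k i = (\<Sum>j = i + 1..length \<alpha>. \<alpha> ! (j - 1) - 1)"
begin

lemma k_Suc: "i < length \<alpha> \<Longrightarrow> k i = \<alpha> ! i - 1 + k (i + 1)"
  unfolding k by (simp add: sum.atLeast_Suc_atMost)

lemma k_eq_0: "length \<alpha> \<le> i \<Longrightarrow> k i = 0"
  unfolding k by simp

text \<open>Once shifted, the rows below row \<open>i\<close> end at column \<open>k i + 1\<close>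
  at the latest, while row \<open>i\<close> itself resumes at column \<open>k i + 2\<close>.\<close>

lemma offset_le: "(i', j) \<in> cd \<alpha> \<Longrightarrow> i < i' \<Longrightarrow> j + k i' \<le> k i + 1"
proof (induction "length \<alpha> - i" arbitrary: i)
  case (Suc m)
  have i: "k i = \<alpha> ! i - 1 + k (i + 1)" using Suc.hyps(2) by (intro k_Suc) simp
  have m: "m = length \<alpha> - (i + 1)" using Suc.hyps(2) by simp
  show ?case
  proof (cases "i' = i + 1")
    case True
    then show ?thesis using i Suc.prems(1) by (auto simp: cd_def)
  next
    case False
    then show ?thesis using Suc.hyps(1)[OF m] Suc.prems i by simp
  qed
qed (auto simp: cd_def)

text \<open>Going up by one row adds as many columns as that row has boxes beyond its first, so the
  rows below \<open>i\<close> leave no gap in the columns from 2 to \<open>k i + 1\<close>.\<close>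

lemma offset_surj:
  "2 \<le> c \<Longrightarrow> c \<le> k i + 1 \<Longrightarrow> \<exists>i' j. (i', j) \<in> cd \<alpha> \<and> i < i' \<and> 2 \<le> j \<and> c = j + k i'"
proof (induction "length \<alpha> - i" arbitrary: i)
  case 0
  then show ?case using k_eq_0[of i] by simp
next
  case (Suc m)
  have i: "k i = \<alpha> ! i - 1 + k (i + 1)" using Suc.hyps(2) by (intro k_Suc) simp
  have m: "m = length \<alpha> - (i + 1)" using Suc.hyps(2) by simp
  show ?case
  proof (cases "c \<le> k (i + 1) + 1")
    case True
    then obtain i' j where "(i', j) \<in> cd \<alpha> \<and> i + 1 < i' \<and> 2 \<le> j \<and> c = j + k i'"
      using Suc.hyps(1)[OF m Suc.prems(1)] by blast
    then show ?thesis by (intro exI[of _ i'] exI[of _ j]) simp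
  next
    case False
    then show ?thesis
      using Suc.prems Suc.hyps(2) i
      by (intro exI[of _ "i + 1"] exI[of _ "c - k (i + 1)"]) (auto simp: cd_def)
  qed
qed

text \<open>Every box outside the first column gets a column of its own, in the order in which
  \<open>filling_V'\<close> numbers these boxes: from the bottom row upwards, and from left to right
  in each row.\<close>

definition column_V :: "nat \<times> nat \<Rightarrow> nat" where
  "column_V = (\<lambda>(i, j). if j = 1 then 1 else j + k i)"

lemma first_column: "{c \<in> cd \<alpha>. snd c = 1 \<and> fst c \<le> i} = (\<lambda>i'. (i', 1)) ` {1..min i (length \<alpha>)}"
  (is "?L = ?R")
proof
  show "?L \<subseteq> ?R" by (auto simp: cd_def)
  show "?R \<subseteq> ?L"
  proof
    fix c assume "c \<in> ?R"
    then obtain i' where i': "c = (i', 1)" "1 \<le> i'" "i' \<le> i" "i' \<le> length \<alpha>" by auto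
    then have "\<alpha> ! (i' - 1) \<in> set \<alpha>" by (intro nth_mem) auto
    then have "1 \<le> \<alpha> ! (i' - 1)" using comp by (simp add: composition_of_def)
    then show "c \<in> ?L" using i' by (simp add: cd_def)
  qed
qed

lemma card_first_column: "card {c \<in> cd \<alpha>. snd c = 1 \<and> fst c \<le> i} = min i (length \<alpha>)"
  unfolding first_column by (subst card_image) (auto simp: inj_on_def)

lemma column_V_less_iff:
  assumes b: "b \<in> cd \<alpha>" "2 \<le> snd b" and c: "c \<in> cd \<alpha>"
  shows "column_V c < column_V b \<or> column_V c = column_V b \<and> fst c \<le> fst b \<longleftrightarrow>
    snd c = 1 \<or> 2 \<le> snd c \<and> (fst b < fst c \<or> fst c = fst b \<and> snd c \<le> snd b)"
proof -
  obtain i j i' j' where eq: "b = (i, j)" "c = (i', j')" by fastforce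
  have j': "1 \<le> j'" using c eq by (auto simp: cd_def)
  have xb: "column_V b = j + k i" and j: "2 \<le> j" using b(2) by (auto simp: column_V_def eq)
  show ?thesis
  proof (cases "j' = 1")
    case True
    then show ?thesis using xb j by (simp add: eq) (simp add: column_V_def)
  next
    case False
    then have xc: "column_V c = j' + k i'" "2 \<le> j'" using j' by (auto simp: column_V_def eq)
    show ?thesis
    proof (cases i i' rule: linorder_cases)
      case less
      then have "j' + k i' \<le> k i + 1" using offset_le c eq by blast
      then show ?thesis using less xb xc j by (simp add: eq)
    next
      case equal
      then show ?thesis using xb xc j by (auto simp: eq)
    next
      case greater
      then have "j + k i \<le> k i' + 1" using offset_le b eq by blast
      then show ?thesis using greater xb xc j by (simp add: eq)
    qed
  qed
qed

text \<open>For a box of the first column the rank is its row number. For any other box the whole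
  first column comes before it, which is the summand \<open>length \<alpha>\<close>; the remaining
  predecessors are those counted in \<open>filling_V'\<close>.\<close>

lemma filling_V'_rank:
  assumes b: "b \<in> cd \<alpha>"
  shows "filling_V' \<alpha> b = card {c \<in> cd \<alpha>. column_V c < column_V b \<or> column_V c = column_V b \<and> fst c \<le> fst b}"
proof -
  obtain i j where ij: "b = (i, j)" by fastforce
  have i: "1 \<le> i" "i \<le> length \<alpha>" "1 \<le> j" using b ij by (auto simp: cd_def)
  show ?thesis
  proof (cases "j = 1")
    case True
    have "column_V c < column_V b \<or> column_V c = column_V b \<and> fst c \<le> fst b \<longleftrightarrow> snd c = 1 \<and> fst c \<le> i"
      if "c \<in> cd \<alpha>" for c
      using that by (cases c) (auto simp: column_V_def ij True cd_def)
    then have "{c \<in> cd \<alpha>. column_V c < column_V b \<or> column_V c = column_V b \<and> fst c \<le> fst b} =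
        {c \<in> cd \<alpha>. snd c = 1 \<and> fst c \<le> i}" by blast
    then show ?thesis using card_first_column[of i] i by (simp add: filling_V'_def ij True)
  next
    case False
    let ?F = "{c \<in> cd \<alpha>. snd c = 1 \<and> fst c \<le> length \<alpha>}"
    let ?R = "{c \<in> cd \<alpha>. 2 \<le> snd c \<and> (i < fst c \<or> fst c = i \<and> snd c \<le> j)}"
    have "{c \<in> cd \<alpha>. column_V c < column_V b \<or> column_V c = column_V b \<and> fst c \<le> fst b} =
        {c \<in> cd \<alpha>. snd c = 1 \<or> 2 \<le> snd c \<and> (fst b < fst c \<or> fst c = fst b \<and> snd c \<le> snd b)}"
      using column_V_less_iff[OF b] i False by (intro Collect_cong conj_cong refl) (auto simp: ij)
    also have "\<dots> = ?F \<union> ?R" by (auto simp: ij cd_def)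
    finally have "card {c \<in> cd \<alpha>. column_V c < column_V b \<or> column_V c = column_V b \<and> fst c \<le> fst b} =
        card ?F + card ?R"
      by (simp only:) (rule card_Un_disjoint; auto)
    moreover have "?R = {(i', j') \<in> cd \<alpha>. j' \<ge> 2 \<and> (i' > i \<or> i' = i \<and> j' \<le> j)}" by auto
    ultimately show ?thesis
      using card_first_column[of "length \<alpha>"] False by (simp add: filling_V'_def ij)
  qed
qed

lemma column_filling_V': "column_filling n \<alpha> (filling_V' \<alpha>) column_V"
proof
  show "composition_of n \<alpha>" by (rule comp)
  show "column_V (i, j) < column_V (i, j')" if "(i, j) \<in> cd \<alpha>" "j < j'" for i j j'
    using that by (auto simp: column_V_def cd_def)
  show "1 \<le> column_V b" if "b \<in> cd \<alpha>" for b
    using that by (auto simp: column_V_def cd_def)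
  show "filling_V' \<alpha> b = card {c \<in> cd \<alpha>. column_V c < column_V b \<or> column_V c = column_V b \<and> fst c \<le> fst b}"
    if "b \<in> cd \<alpha>" for b
    using that by (rule filling_V'_rank)
  show "\<exists>b'\<in>cd \<alpha>. column_V b' = c" if b: "b \<in> cd \<alpha>" and c: "1 \<le> c" "c \<le> column_V b" for b c
  proof -
    obtain i j where ij: "b = (i, j)" by fastforce
    \<comment> \<open>Column \<open>c\<close> is the first one, or is occupied by a row below
      \<open>i\<close>, or belongs to row \<open>i\<close> itself, where undoing the shift gives its
      box.\<close>
    consider "c = 1" | "2 \<le> c" "c \<le> k i + 1" | "k i + 2 \<le> c" using c by linarith
    then show ?thesis
    proof cases
      case 1
      then show ?thesis using b ij by (intro bexI[of _ "(i, 1)"]) (auto simp: column_V_def cd_def)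
    next
      case 2
      then obtain i' j' where "(i', j') \<in> cd \<alpha> \<and> i < i' \<and> 2 \<le> j' \<and> c = j' + k i'"
        using offset_surj by blast
      then show ?thesis by (intro bexI[of _ "(i', j')"]) (auto simp: column_V_def)
    next
      case 3
      then show ?thesis using b c ij
        by (intro bexI[of _ "(i, c - k i)"]) (auto simp: column_V_def cd_def split: if_splits)
    qed
  qed
  show "\<exists>c\<in>cd \<alpha>. column_V c = column_V b \<and> fst b < fst c \<or> column_V c = column_V b' \<and> fst c < fst b'"
    if b: "b \<in> cd \<alpha>" and b': "b' \<in> cd \<alpha>"
      and step: "column_V b' = column_V b + 1" and less: "fst b < fst b'" for b b'
  proof -
    obtain i j i' j' where eq: "b = (i, j)" "b' = (i', j')" by fastforce
    have j: "1 \<le> j" "1 \<le> j'" using b b' eq by (auto simp: cd_def)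
    \<comment> \<open>For \<open>j \<ge> 2\<close> the column of \<open>b\<close> exceeds every
      column occupied by lower rows, so \<open>b'\<close> could not come in the next one. With
      \<open>b\<close> in the first column, the first box of the row of \<open>b'\<close> lies below
      it.\<close>
    have "j = 1"
      using offset_le[of i' j' i] b' step less j unfolding eq column_V_def by (auto split: if_splits)
    moreover have "(i', 1) \<in> cd \<alpha>" using b' eq by (auto simp: cd_def)
    ultimately show ?thesis
      using less by (intro bexI[of _ "(i', 1)"]) (auto simp: column_V_def eq)
  qed
qed

end

theorem theorem5p8:
  fixes n :: nat and \<alpha> :: "nat list" and k :: "nat \<Rightarrow> nat"
  assumes "composition_of n \<alpha>"
    and "\<And>i. k i = (\<Sum>j = i + 1..length \<alpha>. \<alpha> ! (j - 1) - 1)"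
  shows "(P_V \<alpha> = P_D (D_boxes (comp_compl \<alpha>) (read_perm \<alpha> (filling_V' \<alpha>))) \<and>
          P_X \<alpha> = P_D (D_boxes (comp_compl \<alpha>) (read_perm \<alpha> (filling_X' \<alpha>)))) \<and>
         (D_boxes (comp_compl \<alpha>) (read_perm \<alpha> (filling_V' \<alpha>)) =
            {(1, i) | i. (i, 1) \<in> cd \<alpha>} \<union> {(j + k i, i) | i j. (i, j) \<in> cd \<alpha> \<and> j \<ge> 2} \<and>
          D_boxes (comp_compl \<alpha>) (read_perm \<alpha> (filling_X' \<alpha>)) =
            {(i, j). (j, i) \<in> cd \<alpha>})"
proof -
  interpret column_offsets n \<alpha> k using assms by unfold_locales
  interpret V: column_filling n \<alpha> "filling_V' \<alpha>" column_V by (rule column_filling_V')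
  interpret X: column_filling n \<alpha> "filling_X' \<alpha>" snd by (rule column_filling_X'[OF assms(1)])
  have "P_V \<alpha> = P_D (D_boxes (comp_compl \<alpha>) (read_perm \<alpha> (filling_V' \<alpha>)))"
    unfolding P_V_def V.D_boxes_eq V.sum_list_eq by (rule V.interval_poset_eq_P_D)
  moreover have "P_X \<alpha> = P_D (D_boxes (comp_compl \<alpha>) (read_perm \<alpha> (filling_X' \<alpha>)))"
    unfolding P_X_def X.D_boxes_eq X.sum_list_eq by (rule X.interval_poset_eq_P_D)
  moreover have "D_boxes (comp_compl \<alpha>) (read_perm \<alpha> (filling_V' \<alpha>)) =
      {(1, i) | i. (i, 1) \<in> cd \<alpha>} \<union> {(j + k i, i) | i j. (i, j) \<in> cd \<alpha> \<and> j \<ge> 2}"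
  proof -
    have coords: "(p, q) \<in> (\<lambda>b. (column_V b, fst b)) ` cd \<alpha> \<longleftrightarrow>
        p = 1 \<and> (q, 1) \<in> cd \<alpha> \<or> (\<exists>j. p = j + k q \<and> (q, j) \<in> cd \<alpha> \<and> j \<ge> 2)" (is "_ \<longleftrightarrow> ?R") for p q
    proof
      assume "(p, q) \<in> (\<lambda>b. (column_V b, fst b)) ` cd \<alpha>"
      then obtain j where j: "(q, j) \<in> cd \<alpha>" "p = column_V (q, j)" by auto
      then have "j = 1 \<or> 2 \<le> j" by (auto simp: cd_def)
      then show ?R using j by (auto simp: column_V_def)
    next
      assume ?R
      \<comment> \<open>The first alternative is the case \<open>j = 1\<close>, in which
        \<open>column_V\<close> ignores the offset.\<close>
      then obtain j where "(q, j) \<in> cd \<alpha>" "p = column_V (q, j)"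
        unfolding column_V_def by fastforce
      then show "(p, q) \<in> (\<lambda>b. (column_V b, fst b)) ` cd \<alpha>" by force
    qed
    show ?thesis
      unfolding V.D_boxes_eq
    proof (rule Set.set_eqI)
      fix d :: "nat \<times> nat"
      obtain p q where "d = (p, q)" by fastforce
      then show "d \<in> (\<lambda>b. (column_V b, fst b)) ` cd \<alpha> \<longleftrightarrow>
          d \<in> {(1, i) | i. (i, 1) \<in> cd \<alpha>} \<union> {(j + k i, i) | i j. (i, j) \<in> cd \<alpha> \<and> j \<ge> 2}"
        using coords[of p q] by blast
    qed
  qed
  moreover have "D_boxes (comp_compl \<alpha>) (read_perm \<alpha> (filling_X' \<alpha>)) = {(i, j). (j, i) \<in> cd \<alpha>}"
    unfolding X.D_boxes_eq by force
  ultimately show ?thesis by blast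
qed

end
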